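(* Let $K$ be an attractor for a flow or a semiflow and let $Z$ be its basin of attraction. Then the inclusion $K\subseteq Z$ induces isomorphisms $\check H^*(Z;\mathbb K)\to\check H^*(K;\mathbb K)$ in Čech cohomology.
   Context: $\check H^*$ denotes Čech (equivalently Alexander–Spanier) cohomology with coefficients in a field $\mathbb K$ ($\mathbb Q$ or $\mathbb C$). The space $Z$ is assumed paracompact Hausdorff. A semiflow on a space is a continuous map $(p,t)\mapsto p\cdot t$, $t\in[0,\infty)$, with $p\cdot 0=p$ and $(p\cdot s)\cdot t=p\cdot(s+t)$ (a flow is the same with $t\in\mathbb R$). An attractor $K$ is a compact invariant set which is asymptotically stable: it has a neighbourhood basis of positively invariant sets, and it has a neighbourhood all of whose points have forward trajectories eventually entering any prescribed neighbourhood of $K$; its basin of attraction $Z$ is the set of all points whose forward trajectory eventually enters any prescribed neighbourhood of $K$ (an open positively invariant set). *)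

theory Defs
  imports "HOL-Analysis.Analysis" "HOL-Algebra.Module" "HOL-Algebra.AbelCoset"
begin

section \<open>Flows, semiflows and attractors\<close>

text \<open>The set \<open>T\<close> of times is \<open>UNIV\<close> for a flow and \<open>{0..}\<close> for a semiflow.\<close>

definition dynamical_system :: "real set \<Rightarrow> 'a topology \<Rightarrow> ('a \<Rightarrow> real \<Rightarrow> 'a) \<Rightarrow> bool" where
  "dynamical_system T X \<phi> \<longleftrightarrow>
     continuous_map (prod_topology X (top_of_set T)) X (\<lambda>(p, t). \<phi> p t) \<and>
     (\<forall>p\<in>topspace X. \<phi> p 0 = p) \<and>
     (\<forall>p\<in>topspace X. \<forall>s\<in>T. \<forall>t\<in>T. \<phi> (\<phi> p s) t = \<phi> p (s + t))"

abbreviation flow :: "'a topology \<Rightarrow> ('a \<Rightarrow> real \<Rightarrow> 'a) \<Rightarrow> bool" where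
  "flow \<equiv> dynamical_system UNIV"

abbreviation semiflow :: "'a topology \<Rightarrow> ('a \<Rightarrow> real \<Rightarrow> 'a) \<Rightarrow> bool" where
  "semiflow \<equiv> dynamical_system {0..}"

definition invariant_set :: "real set \<Rightarrow> ('a \<Rightarrow> real \<Rightarrow> 'a) \<Rightarrow> 'a set \<Rightarrow> bool" where
  "invariant_set T \<phi> K \<longleftrightarrow> (\<forall>t\<in>T. (\<lambda>p. \<phi> p t) ` K = K)"

definition positively_invariant :: "('a \<Rightarrow> real \<Rightarrow> 'a) \<Rightarrow> 'a set \<Rightarrow> bool" where
  "positively_invariant \<phi> P \<longleftrightarrow> (\<forall>p\<in>P. \<forall>t\<ge>0. \<phi> p t \<in> P)"

text \<open>Neighbourhoods of a set need not be open.\<close>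

definition nbhd_of :: "'a topology \<Rightarrow> 'a set \<Rightarrow> 'a set \<Rightarrow> bool" where
  "nbhd_of X K U \<longleftrightarrow> U \<subseteq> topspace X \<and> K \<subseteq> X interior_of U"

definition attracted_to :: "'a topology \<Rightarrow> ('a \<Rightarrow> real \<Rightarrow> 'a) \<Rightarrow> 'a set \<Rightarrow> 'a \<Rightarrow> bool" where
  "attracted_to X \<phi> K p \<longleftrightarrow> (\<forall>U. nbhd_of X K U \<longrightarrow> (\<forall>\<^sub>F t in at_top. \<phi> p t \<in> U))"

definition asymptotically_stable :: "'a topology \<Rightarrow> ('a \<Rightarrow> real \<Rightarrow> 'a) \<Rightarrow> 'a set \<Rightarrow> bool" where
  "asymptotically_stable X \<phi> K \<longleftrightarrow>
     (\<forall>U. nbhd_of X K U \<longrightarrow> (\<exists>P\<subseteq>U. nbhd_of X K P \<and> positively_invariant \<phi> P)) \<and>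
     (\<exists>N. nbhd_of X K N \<and> (\<forall>p\<in>N. attracted_to X \<phi> K p))"

definition attractor :: "real set \<Rightarrow> 'a topology \<Rightarrow> ('a \<Rightarrow> real \<Rightarrow> 'a) \<Rightarrow> 'a set \<Rightarrow> bool" where
  "attractor T X \<phi> K \<longleftrightarrow>
     compactin X K \<and> invariant_set T \<phi> K \<and> asymptotically_stable X \<phi> K"

definition basin :: "'a topology \<Rightarrow> ('a \<Rightarrow> real \<Rightarrow> 'a) \<Rightarrow> 'a set \<Rightarrow> 'a set" where
  "basin X \<phi> K = {p \<in> topspace X. attracted_to X \<phi> K p}"

definition open_cover :: "'a topology \<Rightarrow> 'a set set \<Rightarrow> bool" where
  "open_cover X \<U> \<longleftrightarrow> (\<forall>U\<in>\<U>. openin X U) \<and> \<Union>\<U> = topspace X"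

definition paracompact_space :: "'a topology \<Rightarrow> bool" where
  "paracompact_space X \<longleftrightarrow>
     (\<forall>\<U>. open_cover X \<U> \<longrightarrow>
        (\<exists>\<V>. open_cover X \<V> \<and> (\<forall>V\<in>\<V>. \<exists>U\<in>\<U>. V \<subseteq> U) \<and> locally_finite_in X \<V>))"


section \<open>Quotients of vector spaces\<close>

text \<open>
  A vector space over a field type \<open>'k\<close> is a \<open>module\<close> record whose scalars
  are all elements of \<open>'k\<close>; the ring multiplication of the record is not used.
\<close>

definition quot_space :: "('k, 'c, 'm) module_scheme \<Rightarrow> 'c set \<Rightarrow> ('k, 'c set) module" where
  "quot_space M N =
     \<lparr>carrier = a_rcosets\<^bsub>M\<^esub> N, mult = undefined, one = undefined,
      zero = N, add = (\<lambda>A B. A <+>\<^bsub>M\<^esub> B),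
      smult = (\<lambda>a A. \<Union>x\<in>A. N +>\<^bsub>M\<^esub> (a \<odot>\<^bsub>M\<^esub> x))\<rparr>"

text \<open>
  The map of quotients induced by \<open>h\<close>, where \<open>N\<close> is the subspace divided out of
  the codomain \<open>M\<close>: if \<open>h\<close> is linear and maps the subspace divided out of its domain
  into \<open>N\<close>, then all the cosets in the union coincide.
\<close>

definition quot_map :: "('k, 'd, 'm) module_scheme \<Rightarrow> 'd set \<Rightarrow> ('c \<Rightarrow> 'd) \<Rightarrow> 'c set \<Rightarrow> 'd set" where
  "quot_map M N h A = (\<Union>x\<in>A. N +>\<^bsub>M\<^esub> h x)"

definition linear_iso :: "('k, 'c, 'm) module_scheme \<Rightarrow> ('k, 'd, 'n) module_scheme \<Rightarrow> ('c \<Rightarrow> 'd) set" where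
  "linear_iso M N =
     {h \<in> iso (add_monoid M) (add_monoid N).
        \<forall>a. \<forall>x\<in>carrier M. h (a \<odot>\<^bsub>M\<^esub> x) = a \<odot>\<^bsub>N\<^esub> h x}"


section \<open>Alexander-Spanier cohomology\<close>

text \<open>
  The Alexander-Spanier complex of \<open>X\<close> consists of the functions on (\<open>q + 1\<close>)-tuples of
  points of \<open>X\<close> modulo those that vanish on all tuples contained in a single member of
  some open cover. Its cohomology is the Cech cohomology of \<open>X\<close>.
\<close>

definition tuples :: "nat \<Rightarrow> 'a topology \<Rightarrow> 'a list set" where
  "tuples q X = {xs. length xs = Suc q \<and> set xs \<subseteq> topspace X}"

definition cochains :: "nat \<Rightarrow> 'a topology \<Rightarrow> ('k::field, 'a list \<Rightarrow> 'k) module" where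
  "cochains q X =
     \<lparr>carrier = extensional (tuples q X), mult = undefined, one = undefined,
      zero = (\<lambda>xs\<in>tuples q X. 0), add = (\<lambda>c d. \<lambda>xs\<in>tuples q X. c xs + d xs),
      smult = (\<lambda>a c. \<lambda>xs\<in>tuples q X. a * c xs)\<rparr>"

definition coboundary :: "nat \<Rightarrow> 'a topology \<Rightarrow> ('a list \<Rightarrow> 'k::field) \<Rightarrow> 'a list \<Rightarrow> 'k" where
  "coboundary q X c =
     (\<lambda>xs\<in>tuples (Suc q) X. \<Sum>i\<le>Suc q. (-1) ^ i * c (take i xs @ drop (Suc i) xs))"

definition pullback :: "nat \<Rightarrow> 'a topology \<Rightarrow> ('a \<Rightarrow> 'b) \<Rightarrow> ('b list \<Rightarrow> 'k::field) \<Rightarrow> 'a list \<Rightarrow> 'k" where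
  "pullback q X f c = (\<lambda>xs\<in>tuples q X. c (map f xs))"

definition locally_zero :: "nat \<Rightarrow> 'a topology \<Rightarrow> ('a list \<Rightarrow> 'k::field) set" where
  "locally_zero q X =
     {c \<in> extensional (tuples q X).
        \<exists>\<U>. open_cover X \<U> \<and> (\<forall>U\<in>\<U>. \<forall>xs\<in>tuples q X. set xs \<subseteq> U \<longrightarrow> c xs = 0)}"

definition as_cochains :: "nat \<Rightarrow> 'a topology \<Rightarrow> ('k::field, ('a list \<Rightarrow> 'k) set) module" where
  "as_cochains q X = quot_space (cochains q X) (locally_zero q X)"

definition as_coboundary ::
    "nat \<Rightarrow> 'a topology \<Rightarrow> ('a list \<Rightarrow> 'k::field) set \<Rightarrow> ('a list \<Rightarrow> 'k) set" where
  "as_coboundary q X =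
     quot_map (cochains (Suc q) X) (locally_zero (Suc q) X) (coboundary q X)"

definition as_pullback ::
    "nat \<Rightarrow> 'a topology \<Rightarrow> ('a \<Rightarrow> 'b) \<Rightarrow> ('b list \<Rightarrow> 'k::field) set \<Rightarrow> ('a list \<Rightarrow> 'k) set" where
  "as_pullback q X f = quot_map (cochains q X) (locally_zero q X) (pullback q X f)"

definition as_cocycles :: "nat \<Rightarrow> 'a topology \<Rightarrow> ('k::field, ('a list \<Rightarrow> 'k) set) module" where
  "as_cocycles q X = (as_cochains q X)
     \<lparr>carrier := {A \<in> carrier (as_cochains q X).
        as_coboundary q X A = \<zero>\<^bsub>as_cochains (Suc q) X\<^esub>}\<rparr>"

definition as_coboundaries :: "nat \<Rightarrow> 'a topology \<Rightarrow> ('a list \<Rightarrow> 'k::field) set set" where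
  "as_coboundaries q X =
     (case q of 0 \<Rightarrow> {\<zero>\<^bsub>as_cochains 0 X\<^esub>}
      | Suc r \<Rightarrow> as_coboundary r X ` carrier (as_cochains r X))"

definition cech_cohomology :: "nat \<Rightarrow> 'a topology \<Rightarrow> ('k::field, ('a list \<Rightarrow> 'k) set set) module" where
  "cech_cohomology q X = quot_space (as_cocycles q X) (as_coboundaries q X)"

text \<open>The homomorphism induced on cohomology by a continuous map \<open>f\<close> with domain \<open>X\<close>.\<close>

definition cech_induced ::
    "nat \<Rightarrow> 'a topology \<Rightarrow> ('a \<Rightarrow> 'b) \<Rightarrow> ('b list \<Rightarrow> 'k::field) set set \<Rightarrow> ('a list \<Rightarrow> 'k) set set" where
  "cech_induced q X f = quot_map (as_cocycles q X) (as_coboundaries q X) (as_pullback q X f)"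

end

theory Submission
  imports Defs
begin

text \<open>
  Write \<open>Z\<close> for the basin of the attractor \<open>K\<close>. Both halves of the statement come from
  (discontinuous) maps \<open>g : Z \<rightarrow> K\<close> that carry sufficiently near points of \<open>Z\<close> to near
  points of \<open>K\<close>. Alexander-Spanier cochains are functions on tuples of points, so they can be
  pulled back along such maps just as along continuous ones.

  The map \<open>g\<close> is a composition of two maps. For every open \<open>N \<supseteq> K\<close> some positively
  invariant neighbourhood of \<open>K\<close> lies in \<open>N\<close>, and every point of \<open>Z\<close> enters it at a time that
  is locally bounded. Since \<open>Z\<close> is paracompact Hausdorff, a continuous function \<open>\<tau>\<close>
  dominates these times (\<open>continuous_majorant\<close>), so \<open>r p = \<phi> p (\<tau> p)\<close> maps \<open>Z\<close>
  continuously into \<open>N\<close>. The homotopy \<open>\<phi> p (s * \<tau> p)\<close> joins the identity to \<open>r\<close> within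
  \<open>Z\<close>, and also within \<open>K\<close> because \<open>K\<close> is positively invariant. The second map
  \<open>f : N \<rightarrow> K\<close> moves each point to a nearby point of \<open>K\<close> and fixes \<open>K\<close>; for a given
  cover it exists on a small enough \<open>N\<close> because \<open>K\<close> is compact (\<open>near_retraction\<close>).
  Put \<open>g = f \<circ> r\<close>.

  If \<open>c\<close> is a cocycle on \<open>Z\<close> whose restriction to \<open>K\<close> is the coboundary of \<open>b\<close>, then \<open>c\<close> is
  cohomologous to \<open>c \<circ> r\<close> by homotopy, \<open>c \<circ> r\<close> to \<open>c \<circ> g\<close> because \<open>r\<close> and \<open>g\<close> are
  close to each other, and \<open>c \<circ> g\<close> is the coboundary of \<open>b \<circ> g\<close>. If \<open>c\<close> is a cocycle
  on \<open>K\<close>, then \<open>c \<circ> g\<close> is a cocycle on \<open>Z\<close>; on \<open>K\<close> it equals \<open>c \<circ> r\<close>, which is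
  cohomologous to \<open>c\<close> by the homotopy within \<open>K\<close>.

  Homotopy invariance rests on the prism operator between two maps that are close to each other
  relative to a cover. As \<open>Z\<close> is not compact, no finite number of steps makes consecutive stages
  of a homotopy close to each other everywhere. The step length is therefore a continuous function
  of the point, each point becomes stationary after finitely many steps, and the infinitely many
  prisms are summed tuple by tuple (\<open>telescoping_homotopy\<close>).
\<close>

section \<open>Quotients of groups with scalars\<close>

text \<open>
  An abelian group on which scalars act by endomorphisms. This is the structure respected by
  \<^const>\<open>linear_iso\<close>, and it passes to quotients, kernels and images.
\<close>
locale scaled_group = abelian_group M for M :: "('k, 'c, 'm) module_scheme" (structure) +
  assumes smult_in_carrier: "x \<in> carrier M \<Longrightarrow> a \<odot> x \<in> carrier M"
    and smult_distrib: "x \<in> carrier M \<Longrightarrow> y \<in> carrier M \<Longrightarrow> a \<odot> (x \<oplus> y) = a \<odot> x \<oplus> a \<odot> y"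

locale scaled_subgroup = scaled_group M + additive_subgroup N M
  for N :: "'c set" and M :: "('k, 'c, 'm) module_scheme" (structure) +
  assumes smult_in_subgroup: "x \<in> N \<Longrightarrow> a \<odot> x \<in> N"

sublocale scaled_subgroup \<subseteq> abelian_subgroup N M
  by (rule abelian_subgroupI3) unfold_locales

definition linear_map :: "('k, 'c, 'm) module_scheme \<Rightarrow> ('k, 'd, 'n) module_scheme \<Rightarrow> ('c \<Rightarrow> 'd) set" where
  "linear_map M M' = {h \<in> carrier M \<rightarrow> carrier M'.
     (\<forall>x\<in>carrier M. \<forall>y\<in>carrier M. h (x \<oplus>\<^bsub>M\<^esub> y) = h x \<oplus>\<^bsub>M'\<^esub> h y) \<and>
     (\<forall>a. \<forall>x\<in>carrier M. h (a \<odot>\<^bsub>M\<^esub> x) = a \<odot>\<^bsub>M'\<^esub> h x)}"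

lemma linear_mapD:
  assumes "h \<in> linear_map M M'" "x \<in> carrier M"
  shows "h x \<in> carrier M'" "h (a \<odot>\<^bsub>M\<^esub> x) = a \<odot>\<^bsub>M'\<^esub> h x"
    "y \<in> carrier M \<Longrightarrow> h (x \<oplus>\<^bsub>M\<^esub> y) = h x \<oplus>\<^bsub>M'\<^esub> h y"
  using assms by (auto simp: linear_map_def)

lemma linear_map_zero_minus:
  assumes "abelian_group M" "abelian_group M'" "h \<in> linear_map M M'"
  shows "h \<zero>\<^bsub>M\<^esub> = \<zero>\<^bsub>M'\<^esub>"
    and "x \<in> carrier M \<Longrightarrow> h (\<ominus>\<^bsub>M\<^esub> x) = \<ominus>\<^bsub>M'\<^esub> h x"
    and "x \<in> carrier M \<Longrightarrow> y \<in> carrier M \<Longrightarrow> h (x \<ominus>\<^bsub>M\<^esub> y) = h x \<ominus>\<^bsub>M'\<^esub> h y"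
proof -
  interpret abelian_group_hom M M' h
    by (rule abelian_group_homI) (use assms in \<open>auto simp: linear_map_def hom_def group_hom_def group_hom_axioms_def abelian_group.a_group\<close>)
  show z: "h \<zero>\<^bsub>M\<^esub> = \<zero>\<^bsub>M'\<^esub>" by (rule hom_zero)
  show m: "x \<in> carrier M \<Longrightarrow> h (\<ominus>\<^bsub>M\<^esub> x) = \<ominus>\<^bsub>M'\<^esub> h x" by (rule hom_a_inv)
  show "x \<in> carrier M \<Longrightarrow> y \<in> carrier M \<Longrightarrow> h (x \<ominus>\<^bsub>M\<^esub> y) = h x \<ominus>\<^bsub>M'\<^esub> h y" for y
    using hom_a_inv by (simp add: a_minus_def)
qed

context scaled_subgroup begin

lemma subspace_scaled_group: "scaled_group (M\<lparr>carrier := N\<rparr>)"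
proof -
  interpret S: comm_group "add_monoid (M\<lparr>carrier := N\<rparr>)"
  proof -
    have "group ((add_monoid M)\<lparr>carrier := N\<rparr>)"
      using a_subgroup add.subgroup_imp_group by blast
    then interpret G: group "add_monoid (M\<lparr>carrier := N\<rparr>)" by simp
    show "comm_group (add_monoid (M\<lparr>carrier := N\<rparr>))"
      by (rule G.group_comm_groupI) (simp add: a_comm)
  qed
  have "abelian_group (M\<lparr>carrier := N\<rparr>)"
    by (intro abelian_group.intro abelian_monoid.intro abelian_group_axioms.intro)
       (rule S.comm_monoid_axioms, rule S.comm_group_axioms)
  then show ?thesis
    by (intro scaled_group.intro scaled_group_axioms.intro)
       (auto simp: smult_in_subgroup smult_distrib)
qed

lemma smult_minus:
  assumes "x \<in> carrier M" "y \<in> carrier M"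
  shows "a \<odot> (x \<ominus> y) = a \<odot> x \<ominus> a \<odot> y"
proof -
  have d: "x \<ominus> y \<in> carrier M" using assms by simp
  have "x = (x \<ominus> y) \<oplus> y" using assms by (simp add: a_minus_def a_assoc l_neg)
  then have "a \<odot> x = a \<odot> (x \<ominus> y) \<oplus> a \<odot> y"
    using smult_distrib[OF d assms(2)] by metis
  then show ?thesis using assms d smult_in_carrier
    by (simp add: a_minus_def a_assoc r_neg)
qed

lemma coset_eq_iff:
  assumes "x \<in> carrier M" "y \<in> carrier M"
  shows "N +> x = N +> y \<longleftrightarrow> x \<ominus> y \<in> N"
proof
  assume "N +> x = N +> y"
  then have "x \<in> N +> y" using a_rcos_self[OF assms(1)] by simp
  then show "x \<ominus> y \<in> N"
    using a_rcos_module_imp[OF assms(2)] by (simp add: minus_eq)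
next
  assume "x \<ominus> y \<in> N"
  then have "x \<in> N +> y" using a_rcos_module[OF assms(2,1)] by (simp add: minus_eq)
  then show "N +> x = N +> y" using a_repr_independence'[OF _ assms(2)] by simp
qed

lemma in_coset:
  assumes "c \<in> carrier M" "x \<in> N +> c"
  shows "x \<in> carrier M" "x \<ominus> c \<in> N"
  using a_elemrcos_carrier[OF assms] a_rcos_module_imp[OF assms] by (simp_all add: minus_eq)

lemma carrier_quot_space: "carrier (quot_space M N) = (\<lambda>x. N +> x) ` carrier M"
  by (auto simp: quot_space_def A_RCOSETS_def')

lemma quot_carrierI: "c \<in> carrier M \<Longrightarrow> N +> c \<in> carrier (quot_space M N)"
  unfolding carrier_quot_space by (rule imageI)

lemma quot_carrierE:
  assumes "A \<in> carrier (quot_space M N)"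
  obtains c where "c \<in> carrier M" "A = N +> c"
proof -
  have "A \<in> (\<lambda>x. N +> x) ` carrier M" using assms by (simp only: carrier_quot_space)
  then show thesis by (rule imageE) (rule that)
qed

lemma quot_smult:
  assumes "c \<in> carrier M"
  shows "a \<odot>\<^bsub>quot_space M N\<^esub> (N +> c) = N +> (a \<odot> c)"
proof -
  have "N +> (a \<odot> x) = N +> (a \<odot> c)" if "x \<in> N +> c" for x
    using that in_coset[OF assms that] assms
    by (simp add: coset_eq_iff smult_in_carrier smult_minus[symmetric] smult_in_subgroup)
  then have "(\<Union>x\<in>N +> c. N +> (a \<odot> x)) = (\<Union>x\<in>N +> c. N +> (a \<odot> c))"
    by (rule SUP_cong[OF refl])
  also have "\<dots> = N +> (a \<odot> c)" using a_rcos_self[OF assms] by blast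
  finally show ?thesis by (simp add: quot_space_def)
qed

lemma quot_add:
  assumes "c \<in> carrier M" "d \<in> carrier M"
  shows "(N +> c) \<oplus>\<^bsub>quot_space M N\<^esub> (N +> d) = N +> (c \<oplus> d)"
  using assms a_rcos_sum by (simp add: quot_space_def)

lemma quot_zero: "\<zero>\<^bsub>quot_space M N\<^esub> = N +> \<zero>"
  by (simp add: quot_space_def a_subset)

lemma coset_eq_zero_iff: "c \<in> carrier M \<Longrightarrow> N +> c = \<zero>\<^bsub>quot_space M N\<^esub> \<longleftrightarrow> c \<in> N"
  unfolding quot_zero using add.inv_one by (simp add: coset_eq_iff a_minus_def a_inv_def)

lemma quot_scaled_group: "scaled_group (quot_space M N)"
proof -
  have "abelian_group (quot_space M N)"
  proof (rule abelian_groupI)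
    show "\<exists>B\<in>carrier (quot_space M N). B \<oplus>\<^bsub>quot_space M N\<^esub> A = \<zero>\<^bsub>quot_space M N\<^esub>"
      if A: "A \<in> carrier (quot_space M N)" for A
    proof -
      obtain c where c: "c \<in> carrier M" "A = N +> c" using A by (rule quot_carrierE)
      then have "(N +> (\<ominus> c)) \<oplus>\<^bsub>quot_space M N\<^esub> A = \<zero>\<^bsub>quot_space M N\<^esub>"
        unfolding quot_zero using quot_add[of "\<ominus> c" c] by (simp add: l_neg)
      moreover have "N +> (\<ominus> c) \<in> carrier (quot_space M N)"
        using c by (intro quot_carrierI) simp
      ultimately show ?thesis by blast
    qed
    show "\<zero>\<^bsub>quot_space M N\<^esub> \<in> carrier (quot_space M N)"
      unfolding quot_zero by (intro quot_carrierI) simp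
    show "A \<oplus>\<^bsub>quot_space M N\<^esub> B \<in> carrier (quot_space M N)"
      "A \<oplus>\<^bsub>quot_space M N\<^esub> B = B \<oplus>\<^bsub>quot_space M N\<^esub> A"
      if "A \<in> carrier (quot_space M N)" "B \<in> carrier (quot_space M N)" for A B
      using that by (auto elim!: quot_carrierE intro!: quot_carrierI simp: quot_add a_comm)
    show "(A \<oplus>\<^bsub>quot_space M N\<^esub> B) \<oplus>\<^bsub>quot_space M N\<^esub> C = A \<oplus>\<^bsub>quot_space M N\<^esub> (B \<oplus>\<^bsub>quot_space M N\<^esub> C)"
      if "A \<in> carrier (quot_space M N)" "B \<in> carrier (quot_space M N)" "C \<in> carrier (quot_space M N)" for A B C
      using that by (auto elim!: quot_carrierE simp: quot_add a_assoc)
    show "\<zero>\<^bsub>quot_space M N\<^esub> \<oplus>\<^bsub>quot_space M N\<^esub> A = A" if A: "A \<in> carrier (quot_space M N)" for A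
    proof -
      obtain c where c: "c \<in> carrier M" "A = N +> c" using A by (rule quot_carrierE)
      then show ?thesis unfolding quot_zero using quot_add[of \<zero> c] by simp
    qed
  qed
  then show ?thesis
    by (intro scaled_group.intro scaled_group_axioms.intro)
      (auto elim!: quot_carrierE intro!: quot_carrierI simp: quot_add quot_smult smult_in_carrier smult_distrib)
qed

end

text \<open>
  A map of quotients is defined by a union over the coset; the union collapses because all the
  cosets in it coincide.
\<close>
lemma quot_map_coset:
  assumes "scaled_subgroup N M" "scaled_subgroup N' M'" "h \<in> linear_map M M'" "h ` N \<subseteq> N'"
    and c: "c \<in> carrier M"
  shows "quot_map M' N' h (N +>\<^bsub>M\<^esub> c) = N' +>\<^bsub>M'\<^esub> h c"
proof -
  interpret A: scaled_subgroup N M by fact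
  interpret B: scaled_subgroup N' M' by fact
  have "N' +>\<^bsub>M'\<^esub> h x = N' +>\<^bsub>M'\<^esub> h c" if "x \<in> N +>\<^bsub>M\<^esub> c" for x
  proof -
    have "h (x \<ominus>\<^bsub>M\<^esub> c) \<in> N'" using A.in_coset(2)[OF c that] assms(4) by blast
    then show ?thesis
      using A.in_coset[OF c that] c linear_mapD(1)[OF assms(3)]
      by (simp add: B.coset_eq_iff linear_map_zero_minus[OF A.abelian_group_axioms B.abelian_group_axioms assms(3)])
  qed
  then have "(\<Union>x\<in>N +>\<^bsub>M\<^esub> c. N' +>\<^bsub>M'\<^esub> h x) = (\<Union>x\<in>N +>\<^bsub>M\<^esub> c. N' +>\<^bsub>M'\<^esub> h c)"
    by (rule SUP_cong[OF refl])
  also have "\<dots> = N' +>\<^bsub>M'\<^esub> h c" using A.a_rcos_self[OF c] by blast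
  finally show ?thesis by (simp add: quot_map_def)
qed

lemma quot_map_linear:
  assumes "scaled_subgroup N M" "scaled_subgroup N' M'" "h \<in> linear_map M M'" "h ` N \<subseteq> N'"
  shows "quot_map M' N' h \<in> linear_map (quot_space M N) (quot_space M' N')"
proof -
  interpret A: scaled_subgroup N M by fact
  interpret B: scaled_subgroup N' M' by fact
  note [simp] = quot_map_coset[OF assms] linear_mapD[OF assms(3)] A.quot_add A.quot_smult B.quot_add B.quot_smult
     A.smult_in_carrier B.smult_in_carrier
  show ?thesis
    by (auto simp: linear_map_def elim!: A.quot_carrierE intro!: B.quot_carrierI)
qed

text \<open>
  The isomorphism criterion that reduces the statement about cohomology to statements about
  representing cocycles. Surjectivity is phrased with a sum rather than a difference since the
  additive inverse of a record with a shrunken carrier is a different term.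
\<close>
lemma quot_map_linear_iso:
  assumes "scaled_subgroup N M" "scaled_subgroup N' M'" "h \<in> linear_map M M'" "h ` N \<subseteq> N'"
    and inj: "\<And>x. x \<in> carrier M \<Longrightarrow> h x \<in> N' \<Longrightarrow> x \<in> N"
    and surj: "\<And>y. y \<in> carrier M' \<Longrightarrow> \<exists>x\<in>carrier M. \<exists>z\<in>N'. y = z \<oplus>\<^bsub>M'\<^esub> h x"
  shows "quot_map M' N' h \<in> linear_iso (quot_space M N) (quot_space M' N')"
proof -
  interpret A: scaled_subgroup N M by fact
  interpret B: scaled_subgroup N' M' by fact
  note qc = quot_map_coset[OF assms(1-4)]
  note ql = quot_map_linear[OF assms(1-4)]
  have "inj_on (quot_map M' N' h) (carrier (quot_space M N))"
  proof (clarsimp simp: inj_on_def A.carrier_quot_space qc)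
    fix x y assume xy: "x \<in> carrier M" "y \<in> carrier M" "N' +>\<^bsub>M'\<^esub> h x = N' +>\<^bsub>M'\<^esub> h y"
    then have "h (x \<ominus>\<^bsub>M\<^esub> y) \<in> N'"
      by (simp add: B.coset_eq_iff linear_mapD(1)[OF assms(3)]
          linear_map_zero_minus[OF A.abelian_group_axioms B.abelian_group_axioms assms(3)])
    then show "N +>\<^bsub>M\<^esub> x = N +>\<^bsub>M\<^esub> y"
      using inj xy by (simp add: A.coset_eq_iff)
  qed
  moreover have "quot_map M' N' h ` carrier (quot_space M N) = carrier (quot_space M' N')"
  proof
    show "quot_map M' N' h ` carrier (quot_space M N) \<subseteq> carrier (quot_space M' N')"
      using ql by (auto simp: linear_map_def)
    show "carrier (quot_space M' N') \<subseteq> quot_map M' N' h ` carrier (quot_space M N)"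
    proof (clarsimp simp: B.carrier_quot_space)
      fix y assume y: "y \<in> carrier M'"
      obtain x z where x: "x \<in> carrier M" and z: "z \<in> N'" "y = z \<oplus>\<^bsub>M'\<^esub> h x"
        using surj[OF y] by blast
      have "y \<ominus>\<^bsub>M'\<^esub> h x \<in> N'"
        using z B.a_subset linear_mapD(1)[OF assms(3) x]
        by (simp add: B.minus_eq B.a_assoc B.r_neg subset_iff)
      then have "N' +>\<^bsub>M'\<^esub> y = quot_map M' N' h (N +>\<^bsub>M\<^esub> x)"
        using x y by (simp add: qc B.coset_eq_iff linear_mapD(1)[OF assms(3)])
      then show "N' +>\<^bsub>M'\<^esub> y \<in> quot_map M' N' h ` carrier (quot_space M N)"
        using x by (auto simp: A.carrier_quot_space)
    qed
  qed
  ultimately show ?thesis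
    using ql by (auto simp: linear_iso_def iso_def hom_def linear_map_def bij_betw_def)
qed

lemma scaled_subgroup_of_subspace:
  assumes "scaled_subgroup S M" "scaled_subgroup N M" "N \<subseteq> S"
  shows "scaled_subgroup N (M\<lparr>carrier := S\<rparr>)"
proof -
  interpret S: scaled_subgroup S M by fact
  interpret N: scaled_subgroup N M by fact
  interpret Q: scaled_group "M\<lparr>carrier := S\<rparr>" by (rule S.subspace_scaled_group)
  have "subgroup N ((add_monoid M)\<lparr>carrier := S\<rparr>)"
    by (rule S.add.subgroup_incl[OF N.a_subgroup S.a_subgroup assms(3)])
  then show ?thesis
    by unfold_locales (auto simp: subgroup_def N.smult_in_subgroup)
qed

lemma scaled_subgroup_zero:
  assumes "scaled_group M" shows "scaled_subgroup {\<zero>\<^bsub>M\<^esub>} M"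
proof -
  interpret scaled_group M by fact
  have "a \<odot>\<^bsub>M\<^esub> \<zero>\<^bsub>M\<^esub> = \<zero>\<^bsub>M\<^esub>" for a
  proof -
    have "a \<odot>\<^bsub>M\<^esub> \<zero>\<^bsub>M\<^esub> \<oplus>\<^bsub>M\<^esub> a \<odot>\<^bsub>M\<^esub> \<zero>\<^bsub>M\<^esub> = a \<odot>\<^bsub>M\<^esub> \<zero>\<^bsub>M\<^esub>"
      using smult_distrib[of "\<zero>\<^bsub>M\<^esub>" "\<zero>\<^bsub>M\<^esub>" a] by simp
    then show ?thesis using smult_in_carrier[of "\<zero>\<^bsub>M\<^esub>" a] by (simp add: add.r_cancel_one')
  qed
  then show ?thesis
    by unfold_locales (auto intro: add.subgroupI simp: add.triv_subgroup)
qed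

lemma kernel_scaled_subgroup:
  assumes "scaled_group M" "scaled_subgroup {\<zero>\<^bsub>M'\<^esub>} M'" "h \<in> linear_map M M'"
  shows "scaled_subgroup {x \<in> carrier M. h x = \<zero>\<^bsub>M'\<^esub>} M"
proof -
  interpret A: scaled_group M by fact
  interpret B: scaled_subgroup "{\<zero>\<^bsub>M'\<^esub>}" M' by fact
  note [simp] = linear_mapD[OF assms(3)] linear_map_zero_minus[OF A.abelian_group_axioms B.abelian_group_axioms assms(3)]
  have [simp]: "a \<odot>\<^bsub>M'\<^esub> \<zero>\<^bsub>M'\<^esub> = \<zero>\<^bsub>M'\<^esub>" for a using B.smult_in_subgroup by blast
  have "subgroup {x \<in> carrier M. h x = \<zero>\<^bsub>M'\<^esub>} (add_monoid M)"
    by (rule A.add.subgroupI) (auto simp flip: a_inv_def)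
  then show ?thesis
    by unfold_locales (auto simp: A.smult_in_carrier subgroup_def additive_subgroup_def)
qed

lemma image_scaled_subgroup:
  assumes "scaled_group M" "scaled_group M'" "h \<in> linear_map M M'"
  shows "scaled_subgroup (h ` carrier M) M'"
proof -
  interpret A: scaled_group M by fact
  interpret B: scaled_group M' by fact
  note [simp] = linear_mapD[OF assms(3)] linear_map_zero_minus[OF A.abelian_group_axioms B.abelian_group_axioms assms(3)]
  have minus: "\<ominus>\<^bsub>M'\<^esub> h x \<in> h ` carrier M" if "x \<in> carrier M" for x
    using that linear_map_zero_minus(2)[OF A.abelian_group_axioms B.abelian_group_axioms assms(3) that]
    by (metis A.a_inv_closed imageI)
  have plus: "h x \<oplus>\<^bsub>M'\<^esub> h y \<in> h ` carrier M" if "x \<in> carrier M" "y \<in> carrier M" for x y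
    using that linear_mapD(3)[OF assms(3) that] by (metis A.a_closed imageI)
  have scale: "a \<odot>\<^bsub>M'\<^esub> h x \<in> h ` carrier M" if "x \<in> carrier M" for a x
    using that linear_mapD(2)[OF assms(3) that] by (metis A.smult_in_carrier imageI)
  have "subgroup (h ` carrier M) (add_monoid M')"
    by (rule B.add.subgroupI) (auto simp: minus plus simp flip: a_inv_def)
  then show ?thesis
    by unfold_locales (auto simp: scale subgroup_def)
qed

section \<open>The coboundary and the prism operator on lists\<close>

text \<open>
  The coboundary as a function on all lists. The recursion splits off the face that omits the head;
  it turns the identities of simplicial algebra into inductions without any sign bookkeeping. The
  complex is augmented: the coboundary of a singleton is the value at the empty list.
\<close>
fun codiff :: "('a list \<Rightarrow> 'k::field) \<Rightarrow> 'a list \<Rightarrow> 'k" where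
  "codiff c [] = 0"
| "codiff c (x # xs) = c xs - codiff (\<lambda>ys. c (x # ys)) xs"

lemma codiff_eq_sum:
  "codiff c xs = (\<Sum>i<length xs. (-1) ^ i * c (take i xs @ drop (Suc i) xs))"
  by (induction c xs rule: codiff.induct)
     (simp_all add: sum.lessThan_Suc_shift sum_negf del: sum.lessThan_Suc)

lemma codiff_diff: "codiff (\<lambda>ys. c ys - d ys) xs = codiff c xs - codiff d xs"
  by (simp add: codiff_eq_sum sum_subtractf algebra_simps)

lemma codiff_add: "codiff (\<lambda>ys. c ys + d ys) xs = codiff c xs + codiff d xs"
  by (simp add: codiff_eq_sum sum.distrib algebra_simps)

lemma codiff_scale: "codiff (\<lambda>ys. a * c ys) xs = a * codiff c xs"
  by (simp add: codiff_eq_sum sum_distrib_left mult.left_commute)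

lemma codiff_sum: "codiff (\<lambda>ys. \<Sum>k\<in>A. c k ys) xs = (\<Sum>k\<in>A. codiff (c k) xs)"
  unfolding codiff_eq_sum sum_distrib_left by (rule sum.swap)

lemma codiff_cong:
  assumes "\<And>ys. set ys \<subseteq> set xs \<Longrightarrow> Suc (length ys) = length xs \<Longrightarrow> c ys = d ys"
  shows "codiff c xs = codiff d xs"
  unfolding codiff_eq_sum
proof (rule sum.cong)
  fix i assume "i \<in> {..<length xs}"
  then have "c (take i xs @ drop (Suc i) xs) = d (take i xs @ drop (Suc i) xs)"
    by (intro assms) (auto dest: in_set_takeD in_set_dropD)
  then show "(-1) ^ i * c (take i xs @ drop (Suc i) xs) = (-1) ^ i * d (take i xs @ drop (Suc i) xs)"
    by simp
qed simp

lemma codiff_map: "codiff c (map f xs) = codiff (\<lambda>ys. c (map f ys)) xs"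
  by (induction xs arbitrary: c) auto

lemma codiff_codiff: "codiff (codiff c) xs = 0"
  by (induction xs arbitrary: c) (simp_all add: codiff_diff)

text \<open>
  The alternating sum over \<open>i\<close> of \<open>c\<close> at
  \<open>g x\<^sub>0, \<dots>, g x\<^sub>i, h x\<^sub>i, \<dots>, h x\<^sub>q\<close>.
\<close>
fun prism :: "('a \<Rightarrow> 'b) \<Rightarrow> ('a \<Rightarrow> 'b) \<Rightarrow> ('b list \<Rightarrow> 'k::field) \<Rightarrow> 'a list \<Rightarrow> 'k" where
  "prism g h c [] = 0"
| "prism g h c (x # xs) = c (g x # h x # map h xs) - prism g h (\<lambda>ys. c (g x # ys)) xs"

lemma prism_diff: "prism g h (\<lambda>ys. c ys - d ys) xs = prism g h c xs - prism g h d xs"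
  by (induction xs arbitrary: c d) auto

text \<open>The prism operator is a chain homotopy between the pullbacks along \<open>g\<close> and \<open>h\<close>.\<close>
lemma prism_homotopy:
  "prism g h (codiff c) xs + codiff (prism g h c) xs = c (map h xs) - c (map g xs)"
proof (induction xs arbitrary: c)
  case (Cons x xs)
  show ?case
    using Cons.IH[of "\<lambda>ys. c (g x # ys)"] by (simp add: prism_diff codiff_diff codiff_map algebra_simps)
qed simp

lemma prism_cong:
  fixes c :: "'b list \<Rightarrow> 'k::field"
  assumes "\<And>y. y \<in> set xs \<Longrightarrow> g y = g' y" "\<And>y. y \<in> set xs \<Longrightarrow> h y = h' y"
  shows "prism g h c xs = prism g' h' c xs"
  using assms
proof (induction xs arbitrary: c)
  case (Cons x xs)
  then have "map h xs = map h' xs" "g x = g' x" "h x = h' x" by auto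
  moreover have "prism g h d xs = prism g' h' d xs" for d :: "'b list \<Rightarrow> 'k" using Cons by auto
  ultimately show ?case by (simp only: prism.simps)
qed simp

lemma prism_eq_0:
  assumes "\<And>ys. set ys \<subseteq> g ` set xs \<union> h ` set xs \<Longrightarrow> length ys = Suc (length xs) \<Longrightarrow> c ys = 0"
  shows "prism g h c xs = 0"
  using assms
proof (induction xs arbitrary: c)
  case (Cons x xs)
  have "prism g h (\<lambda>ys. c (g x # ys)) xs = 0"
    by (rule Cons.IH, rule Cons.prems) auto
  moreover have "c (g x # h x # map h xs) = 0" by (rule Cons.prems) auto
  ultimately show ?case by simp
qed simp

section \<open>Cochains near the diagonal\<close>

text \<open>
  Properties that hold near the diagonal, in the sense of open covers. No length is fixed, so that
  one notion serves all degrees.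
\<close>
definition for_small :: "'a topology \<Rightarrow> ('a list \<Rightarrow> bool) \<Rightarrow> bool" where
  "for_small X P \<longleftrightarrow> (\<exists>\<U>. open_cover X \<U> \<and> (\<forall>U\<in>\<U>. \<forall>xs. set xs \<subseteq> U \<longrightarrow> P xs))"

lemma for_small_mono:
  assumes "for_small X P" "\<And>xs. set xs \<subseteq> topspace X \<Longrightarrow> P xs \<Longrightarrow> Q xs"
  shows "for_small X Q"
proof -
  obtain \<U> where U: "open_cover X \<U>" "\<forall>U\<in>\<U>. \<forall>xs. set xs \<subseteq> U \<longrightarrow> P xs"
    using assms(1) by (auto simp: for_small_def)
  then have "U \<subseteq> topspace X" if "U \<in> \<U>" for U
    using that by (auto simp: open_cover_def)
  then show ?thesis
    unfolding for_small_def using U assms(2) by (intro exI[of _ \<U>]) (meson subset_trans)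
qed

lemma for_small_all: "(\<And>xs. set xs \<subseteq> topspace X \<Longrightarrow> P xs) \<Longrightarrow> for_small X P"
  unfolding for_small_def open_cover_def by (rule exI[of _ "{topspace X}"]) auto

lemma for_small_conj:
  assumes "for_small X P" "for_small X Q"
  shows "for_small X (\<lambda>xs. P xs \<and> Q xs)"
proof -
  obtain \<U> where U: "open_cover X \<U>" "\<forall>U\<in>\<U>. \<forall>xs. set xs \<subseteq> U \<longrightarrow> P xs"
    using assms(1) unfolding for_small_def by blast
  obtain \<V> where V: "open_cover X \<V>" "\<forall>V\<in>\<V>. \<forall>xs. set xs \<subseteq> V \<longrightarrow> Q xs"
    using assms(2) unfolding for_small_def by blast
  define \<W> where "\<W> = (\<lambda>(U, V). U \<inter> V) ` (\<U> \<times> \<V>)"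
  have "\<Union>\<W> = \<Union>\<U> \<inter> \<Union>\<V>" by (auto simp: \<W>_def)
  then have "open_cover X \<W>"
    using U(1) V(1) by (auto simp: open_cover_def \<W>_def)
  moreover have "\<forall>W\<in>\<W>. \<forall>xs. set xs \<subseteq> W \<longrightarrow> P xs \<and> Q xs"
    using U(2) V(2) by (auto simp: \<W>_def)
  ultimately show ?thesis unfolding for_small_def by blast
qed

lemma for_smallI_pointwise:
  assumes "\<And>x. x \<in> topspace X \<Longrightarrow> \<exists>U. openin X U \<and> x \<in> U \<and> (\<forall>xs. set xs \<subseteq> U \<longrightarrow> P xs)"
  shows "for_small X P"
proof -
  define \<U> where "\<U> = {U. openin X U \<and> (\<forall>xs. set xs \<subseteq> U \<longrightarrow> P xs)}"
  have "\<Union>\<U> \<subseteq> topspace X" unfolding \<U>_def using openin_subset by blast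
  moreover have "topspace X \<subseteq> \<Union>\<U>"
  proof
    fix x assume "x \<in> topspace X"
    from assms[OF this] show "x \<in> \<Union>\<U>" unfolding \<U>_def by blast
  qed
  ultimately have "open_cover X \<U>" by (auto simp: open_cover_def \<U>_def)
  then show ?thesis unfolding for_small_def by (intro exI[of _ \<U>]) (auto simp: \<U>_def)
qed

lemma for_smallD_pointwise:
  assumes "for_small X P" "x \<in> topspace X"
  obtains U where "openin X U" "x \<in> U" "\<And>xs. set xs \<subseteq> U \<Longrightarrow> P xs"
proof -
  obtain \<U> where U: "open_cover X \<U>" "\<forall>U\<in>\<U>. \<forall>xs. set xs \<subseteq> U \<longrightarrow> P xs"
    using assms(1) unfolding for_small_def by blast
  then have "x \<in> \<Union>\<U>" using assms(2) by (simp add: open_cover_def)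
  then obtain U where "U \<in> \<U>" "x \<in> U" by (rule UnionE)
  then show thesis using U by (intro that[of U]) (auto simp: open_cover_def)
qed

lemma for_small_pullback:
  assumes "for_small Y P" "continuous_map X Y f"
  shows "for_small X (\<lambda>xs. P (map f xs))"
proof (rule for_smallI_pointwise)
  fix x assume x: "x \<in> topspace X"
  then obtain U where U: "openin Y U" "f x \<in> U" "\<And>xs. set xs \<subseteq> U \<Longrightarrow> P xs"
    using for_smallD_pointwise[OF assms(1)] continuous_map_image_subset_topspace[OF assms(2)] by blast
  show "\<exists>U. openin X U \<and> x \<in> U \<and> (\<forall>xs. set xs \<subseteq> U \<longrightarrow> P (map f xs))"
    using U x openin_continuous_map_preimage[OF assms(2) U(1)]
    by (intro exI[of _ "{x \<in> topspace X. f x \<in> U}"]) (auto intro!: U(3))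
qed

definition cocycle :: "nat \<Rightarrow> 'a topology \<Rightarrow> ('a list \<Rightarrow> 'k::field) \<Rightarrow> bool" where
  "cocycle q X c \<longleftrightarrow> for_small X (\<lambda>xs. length xs = Suc (Suc q) \<longrightarrow> codiff c xs = 0)"

text \<open>
  Being a coboundary up to a locally zero cochain. In degree \<open>0\<close> the condition \<open>b [] = 0\<close>
  makes the right-hand side vanish on singletons, so the case in which there are no cochains of
  lower degree needs no separate treatment.
\<close>
definition cobounds :: "nat \<Rightarrow> 'a topology \<Rightarrow> ('a list \<Rightarrow> 'k::field) \<Rightarrow> bool" where
  "cobounds q X c \<longleftrightarrow> (\<exists>b. b [] = 0 \<and> for_small X (\<lambda>xs. length xs = Suc q \<longrightarrow> c xs = codiff b xs))"

lemma cobounds_diff_trans: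
  assumes "cobounds q X (\<lambda>xs. c xs - d xs)" "cobounds q X d"
  shows "cobounds q X c"
proof -
  obtain a b where a: "a [] = 0" "for_small X (\<lambda>xs. length xs = Suc q \<longrightarrow> c xs - d xs = codiff a xs)"
    and b: "b [] = 0" "for_small X (\<lambda>xs. length xs = Suc q \<longrightarrow> d xs = codiff b xs)"
    using assms by (auto simp: cobounds_def)
  have "for_small X (\<lambda>xs. length xs = Suc q \<longrightarrow> c xs = codiff (\<lambda>ys. a ys + b ys) xs)"
    by (rule for_small_mono[OF for_small_conj[OF a(2) b(2)]]) (auto simp: codiff_add algebra_simps)
  then show ?thesis unfolding cobounds_def using a(1) b(1)
    by (intro exI[of _ "\<lambda>ys. a ys + b ys"]) auto
qed

lemma cobounds_minus:
  assumes "cobounds q X (\<lambda>xs. c xs - d xs)"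
  shows "cobounds q X (\<lambda>xs. d xs - c xs)"
proof -
  obtain b where b: "b [] = 0" "for_small X (\<lambda>xs. length xs = Suc q \<longrightarrow> c xs - d xs = codiff b xs)"
    using assms by (auto simp: cobounds_def)
  have "codiff (\<lambda>ys. - b ys) xs = - codiff b xs" for xs
    by (simp add: codiff_eq_sum sum_negf)
  then have "for_small X (\<lambda>xs. length xs = Suc q \<longrightarrow> d xs - c xs = codiff (\<lambda>ys. - b ys) xs)"
    by (intro for_small_mono[OF b(2)]) (simp, metis minus_diff_eq)
  then show ?thesis unfolding cobounds_def using b(1) by (intro exI[of _ "\<lambda>ys. - b ys"]) simp
qed

lemma cobounds_cong:
  assumes "cobounds q X c" "\<And>xs. set xs \<subseteq> topspace X \<Longrightarrow> length xs = Suc q \<Longrightarrow> c xs = d xs"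
  shows "cobounds q X d"
proof -
  obtain b where b: "b [] = 0" "for_small X (\<lambda>xs. length xs = Suc q \<longrightarrow> c xs = codiff b xs)"
    using assms(1) by (auto simp: cobounds_def)
  have "for_small X (\<lambda>xs. length xs = Suc q \<longrightarrow> d xs = codiff b xs)"
    by (rule for_small_mono[OF b(2)]) (use assms(2) in auto)
  then show ?thesis unfolding cobounds_def using b(1) by blast
qed

lemma cobounds_imp_cocycle:
  fixes c :: "'a list \<Rightarrow> 'k::field"
  assumes "cobounds q X c" shows "cocycle q X c"
proof -
  obtain b \<U> where U: "open_cover X \<U>"
    "\<forall>U\<in>\<U>. \<forall>xs. set xs \<subseteq> U \<longrightarrow> length xs = Suc q \<longrightarrow> c xs = codiff b xs"
    using assms unfolding cobounds_def for_small_def by blast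
  have "codiff c xs = 0" if "U \<in> \<U>" "set xs \<subseteq> U" "length xs = Suc (Suc q)" for U xs
  proof -
    have "codiff c xs = codiff (codiff b) xs"
    proof (rule codiff_cong)
      fix ys assume "set ys \<subseteq> set xs" "Suc (length ys) = length xs"
      then show "c ys = codiff b ys" using U(2) that by auto
    qed
    then show ?thesis by (simp add: codiff_codiff)
  qed
  then show ?thesis using U(1) unfolding cocycle_def for_small_def by blast
qed

lemma pullback_cobounds:
  assumes f: "continuous_map X Y f" and c: "cobounds q Y c"
  shows "cobounds q X (\<lambda>xs. c (map f xs))"
proof -
  obtain b where b: "b [] = 0" "for_small Y (\<lambda>xs. length xs = Suc q \<longrightarrow> c xs = codiff b xs)"
    using c unfolding cobounds_def by blast
  have "for_small X (\<lambda>xs. length xs = Suc q \<longrightarrow> c (map f xs) = codiff (\<lambda>ys. b (map f ys)) xs)"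
    by (rule for_small_mono[OF for_small_pullback[OF b(2) f]]) (simp add: codiff_map)
  then show ?thesis unfolding cobounds_def using b(1) by (intro exI[of _ "\<lambda>ys. b (map f ys)"]) simp
qed

section \<open>Induced isomorphisms in terms of representing cochains\<close>

lemma cochains_simps [simp]:
  "carrier (cochains q X) = extensional (tuples q X)"
  "\<zero>\<^bsub>cochains q X\<^esub> = (\<lambda>xs\<in>tuples q X. 0)"
  "c \<oplus>\<^bsub>cochains q X\<^esub> d = (\<lambda>xs\<in>tuples q X. c xs + d xs)"
  "a \<odot>\<^bsub>cochains q X\<^esub> c = (\<lambda>xs\<in>tuples q X. a * c xs)"
  by (simp_all add: cochains_def)

lemma scaled_group_cochains: "scaled_group (cochains q X :: ('k::field, 'a list \<Rightarrow> 'k) module)"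
proof -
  have "abelian_group (cochains q X :: ('k, 'a list \<Rightarrow> 'k) module)"
  proof (rule abelian_groupI)
    show "\<exists>d\<in>carrier (cochains q X). d \<oplus>\<^bsub>cochains q X\<^esub> c = \<zero>\<^bsub>cochains q X\<^esub>"
      if "c \<in> carrier (cochains q X)" for c :: "'a list \<Rightarrow> 'k"
      by (rule bexI[of _ "\<lambda>xs\<in>tuples q X. - c xs"]) (auto simp: restrict_def extensional_def)
  qed (auto simp: restrict_def fun_eq_iff extensional_def add.assoc add.commute)
  then show ?thesis
    by (intro scaled_group.intro scaled_group_axioms.intro)
       (auto simp: fun_eq_iff distrib_left restrict_def extensional_def)
qed

lemma cochains_uminus:
  fixes c :: "'a list \<Rightarrow> 'k::field"
  assumes "c \<in> extensional (tuples q X)"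
  shows "\<ominus>\<^bsub>cochains q X\<^esub> c = (\<lambda>xs\<in>tuples q X. - c xs)"
proof -
  interpret scaled_group "cochains q X :: ('k, 'a list \<Rightarrow> 'k) module" by (rule scaled_group_cochains)
  show ?thesis
    by (rule minus_equality) (use assms in \<open>auto simp: restrict_def extensional_def\<close>)
qed

lemma cochains_minus:
  fixes c d :: "'a list \<Rightarrow> 'k::field"
  assumes "c \<in> extensional (tuples q X)" "d \<in> extensional (tuples q X)"
  shows "c \<ominus>\<^bsub>cochains q X\<^esub> d = (\<lambda>xs\<in>tuples q X. c xs - d xs)"
  using assms by (auto simp: a_minus_def cochains_uminus restrict_def)

lemma locally_zero_iff:
  "c \<in> locally_zero q X \<longleftrightarrow>
     c \<in> extensional (tuples q X) \<and> for_small X (\<lambda>xs. length xs = Suc q \<longrightarrow> c xs = 0)"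
proof -
  have "(\<exists>\<U>. open_cover X \<U> \<and> (\<forall>U\<in>\<U>. \<forall>xs\<in>tuples q X. set xs \<subseteq> U \<longrightarrow> c xs = 0)) \<longleftrightarrow>
    for_small X (\<lambda>xs. length xs = Suc q \<longrightarrow> c xs = 0)"
    unfolding for_small_def
  proof (intro ex_cong1 conj_cong refl ball_cong)
    fix \<U> U assume "open_cover X \<U>" "U \<in> \<U>"
    then have "U \<subseteq> topspace X" by (auto simp: open_cover_def)
    then show "(\<forall>xs\<in>tuples q X. set xs \<subseteq> U \<longrightarrow> c xs = 0) =
        (\<forall>xs. set xs \<subseteq> U \<longrightarrow> length xs = Suc q \<longrightarrow> c xs = 0)"
      by (auto simp: tuples_def)
  qed
  then show ?thesis by (simp add: locally_zero_def)
qed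

lemma tuplesI: "set xs \<subseteq> topspace X \<Longrightarrow> length xs = Suc q \<Longrightarrow> xs \<in> tuples q X"
  by (simp add: tuples_def)

lemma scaled_subgroup_locally_zero:
  "scaled_subgroup (locally_zero q X) (cochains q X :: ('k::field, 'a list \<Rightarrow> 'k) module)"
proof -
  interpret scaled_group "cochains q X :: ('k, 'a list \<Rightarrow> 'k) module" by (rule scaled_group_cochains)
  have zero: "(\<lambda>xs\<in>tuples q X. 0 :: 'k) \<in> locally_zero q X"
    by (auto simp: locally_zero_iff intro!: for_small_all tuplesI)
  have add: "c \<oplus>\<^bsub>cochains q X\<^esub> d \<in> locally_zero q X"
    if "c \<in> locally_zero q X" "d \<in> locally_zero q X" for c d :: "'a list \<Rightarrow> 'k"
  proof -
    have "for_small X (\<lambda>xs. (length xs = Suc q \<longrightarrow> c xs = 0) \<and> (length xs = Suc q \<longrightarrow> d xs = 0))"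
      using that by (intro for_small_conj) (auto simp: locally_zero_iff)
    then have "for_small X (\<lambda>xs. length xs = Suc q \<longrightarrow> (\<lambda>xs\<in>tuples q X. c xs + d xs) xs = 0)"
      by (rule for_small_mono) (simp add: tuplesI)
    then show ?thesis by (simp add: locally_zero_iff)
  qed
  have smult: "(\<lambda>xs\<in>tuples q X. a * c xs) \<in> locally_zero q X"
    if "c \<in> locally_zero q X" for a and c :: "'a list \<Rightarrow> 'k"
  proof -
    have "for_small X (\<lambda>xs. length xs = Suc q \<longrightarrow> (\<lambda>xs\<in>tuples q X. a * c xs) xs = 0)"
      by (rule for_small_mono[of X "\<lambda>xs. length xs = Suc q \<longrightarrow> c xs = 0"])
         (use that in \<open>auto simp: tuplesI locally_zero_iff\<close>)
    then show ?thesis by (simp add: locally_zero_iff)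
  qed
  have sub: "locally_zero q X \<subseteq> carrier (cochains q X :: ('k, 'a list \<Rightarrow> 'k) module)"
    by (auto simp: locally_zero_iff)
  have neg: "\<ominus>\<^bsub>cochains q X\<^esub> c \<in> locally_zero q X" if "c \<in> locally_zero q X" for c :: "'a list \<Rightarrow> 'k"
    using smult[OF that, of "-1"] that sub by (simp add: cochains_uminus subset_iff)
  have "subgroup (locally_zero q X) (add_monoid (cochains q X :: ('k, 'a list \<Rightarrow> 'k) module))"
  proof (rule add.subgroupI)
    show "locally_zero q X \<noteq> ({} :: ('a list \<Rightarrow> 'k) set)" using zero by blast
  qed (use sub neg add in \<open>simp_all flip: a_inv_def del: cochains_simps\<close>)
  then show ?thesis
    using smult by unfold_locales (auto simp: subgroup_def)
qed

lemma coboundary_eq_codiff: "xs \<in> tuples (Suc q) X \<Longrightarrow> coboundary q X c xs = codiff c xs"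
  by (simp add: coboundary_def codiff_eq_sum tuples_def lessThan_Suc_atMost[symmetric] del: sum.lessThan_Suc)

lemma codiff_restrict:
  assumes "xs \<in> tuples (Suc q) X"
  shows "codiff (restrict c (tuples q X)) xs = codiff c xs"
  by (rule codiff_cong) (use assms in \<open>auto simp: tuples_def\<close>)

lemma coboundary_linear:
  "coboundary q X \<in> linear_map (cochains q X :: ('k::field, 'a list \<Rightarrow> 'k) module) (cochains (Suc q) X)"
proof -
  have "coboundary q X (\<lambda>xs\<in>tuples q X. c xs + d xs) = (\<lambda>xs\<in>tuples (Suc q) X. coboundary q X c xs + coboundary q X d xs)"
    for c d :: "'a list \<Rightarrow> 'k"
  proof
    fix xs show "coboundary q X (\<lambda>xs\<in>tuples q X. c xs + d xs) xs = (\<lambda>xs\<in>tuples (Suc q) X. coboundary q X c xs + coboundary q X d xs) xs"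
      by (cases "xs \<in> tuples (Suc q) X")
         (simp_all add: coboundary_eq_codiff codiff_restrict codiff_add, simp add: coboundary_def)
  qed
  moreover have "coboundary q X (\<lambda>xs\<in>tuples q X. a * c xs) = (\<lambda>xs\<in>tuples (Suc q) X. a * coboundary q X c xs)"
    for a and c :: "'a list \<Rightarrow> 'k"
  proof
    fix xs show "coboundary q X (\<lambda>xs\<in>tuples q X. a * c xs) xs = (\<lambda>xs\<in>tuples (Suc q) X. a * coboundary q X c xs) xs"
      by (cases "xs \<in> tuples (Suc q) X")
         (simp_all add: coboundary_eq_codiff codiff_restrict codiff_scale, simp add: coboundary_def)
  qed
  moreover have "coboundary q X c \<in> extensional (tuples (Suc q) X)" for c :: "'a list \<Rightarrow> 'k"
    by (simp add: coboundary_def)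
  ultimately show ?thesis by (simp add: linear_map_def)
qed

lemma coboundary_locally_zero:
  fixes c :: "'a list \<Rightarrow> 'k::field"
  shows "coboundary q X c \<in> locally_zero (Suc q) X \<longleftrightarrow> cocycle q X c"
proof -
  have "for_small X (\<lambda>xs. length xs = Suc (Suc q) \<longrightarrow> coboundary q X c xs = 0) \<longleftrightarrow> cocycle q X c"
    unfolding cocycle_def
    by (rule iffI; erule for_small_mono) (auto simp: coboundary_eq_codiff tuplesI)
  moreover have "coboundary q X c \<in> extensional (tuples (Suc q) X)" by (simp add: coboundary_def)
  ultimately show ?thesis by (simp add: locally_zero_iff)
qed

lemma locally_zero_imp_cobounds:
  assumes "c \<in> locally_zero q X" shows "cobounds q X c"
  using assms unfolding cobounds_def locally_zero_iff
  by (intro exI[of _ "\<lambda>_. 0"]) (simp add: codiff_eq_sum)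

lemma pullback_apply: "xs \<in> tuples q X \<Longrightarrow> pullback q X f c xs = c (map f xs)"
  by (simp add: pullback_def)

lemma map_tuples: "continuous_map X Y f \<Longrightarrow> xs \<in> tuples q X \<Longrightarrow> map f xs \<in> tuples q Y"
  using continuous_map_image_subset_topspace by (fastforce simp: tuples_def)

lemma pullback_linear:
  assumes "continuous_map X Y f"
  shows "pullback q X f \<in> linear_map (cochains q Y :: ('k::field, 'b list \<Rightarrow> 'k) module) (cochains q X)"
  using map_tuples[OF assms]
  by (auto simp: linear_map_def pullback_def fun_eq_iff restrict_def extensional_def)

lemma pullback_locally_zero:
  assumes f: "continuous_map X Y f"
  shows "pullback q X f ` locally_zero q Y \<subseteq> (locally_zero q X :: ('a list \<Rightarrow> 'k::field) set)"
proof clarify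
  fix c :: "'b list \<Rightarrow> 'k" assume "c \<in> locally_zero q Y"
  then have "for_small Y (\<lambda>xs. length xs = Suc q \<longrightarrow> c xs = 0)" by (simp add: locally_zero_iff)
  from for_small_pullback[OF this f]
  have "for_small X (\<lambda>xs. length xs = Suc q \<longrightarrow> pullback q X f c xs = 0)"
    by (rule for_small_mono) (simp add: pullback_apply tuplesI)
  then show "pullback q X f c \<in> locally_zero q X" by (simp add: locally_zero_iff pullback_def)
qed

lemma pullback_cocycle:
  assumes f: "continuous_map X Y f" and c: "cocycle q Y c"
  shows "cocycle q X (pullback q X f c)"
  unfolding cocycle_def
proof (rule for_small_mono[OF for_small_pullback[OF c[unfolded cocycle_def] f]], rule impI)
  fix xs assume xs: "set xs \<subseteq> topspace X" "length (map f xs) = Suc (Suc q) \<longrightarrow> codiff c (map f xs) = 0"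
    "length xs = Suc (Suc q)"
  then have "xs \<in> tuples (Suc q) X" by (simp add: tuples_def)
  then show "codiff (pullback q X f c) xs = 0"
    using xs by (simp add: pullback_def codiff_restrict codiff_map)
qed

text \<open>The coset in the Alexander-Spanier complex that a function on tuples represents.\<close>
definition as_class :: "nat \<Rightarrow> 'a topology \<Rightarrow> ('a list \<Rightarrow> 'k::field) \<Rightarrow> ('a list \<Rightarrow> 'k) set" where
  "as_class q X c = locally_zero q X +>\<^bsub>cochains q X\<^esub> c"

lemma as_cochains_scaled_group: "scaled_group (as_cochains q X :: ('k::field, ('a list \<Rightarrow> 'k) set) module)"
  unfolding as_cochains_def by (rule scaled_subgroup.quot_scaled_group[OF scaled_subgroup_locally_zero])

lemma as_class_carrier: "c \<in> extensional (tuples q X) \<Longrightarrow> as_class q X c \<in> carrier (as_cochains q X)"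
  unfolding as_cochains_def as_class_def
  by (rule scaled_subgroup.quot_carrierI[OF scaled_subgroup_locally_zero]) simp

lemma as_cochains_carrierE:
  assumes "A \<in> carrier (as_cochains q X)"
  obtains c where "c \<in> extensional (tuples q X)" "A = as_class q X c"
  using assms unfolding as_cochains_def as_class_def
  by (rule scaled_subgroup.quot_carrierE[OF scaled_subgroup_locally_zero]) simp

lemma as_class_eq_iff:
  fixes c d :: "'a list \<Rightarrow> 'k::field"
  assumes "c \<in> extensional (tuples q X)" "d \<in> extensional (tuples q X)"
  shows "as_class q X c = as_class q X d \<longleftrightarrow> for_small X (\<lambda>xs. length xs = Suc q \<longrightarrow> c xs = d xs)"
proof -
  have "as_class q X c = as_class q X d \<longleftrightarrow> (\<lambda>xs\<in>tuples q X. c xs - d xs) \<in> locally_zero q X"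
    unfolding as_class_def
    using scaled_subgroup.coset_eq_iff[OF scaled_subgroup_locally_zero, of c q X d] assms
    by (simp add: cochains_minus)
  also have "\<dots> \<longleftrightarrow> for_small X (\<lambda>xs. length xs = Suc q \<longrightarrow> c xs = d xs)"
    by (auto simp: locally_zero_iff tuplesI elim!: for_small_mono)
  finally show ?thesis .
qed

lemma as_class_add:
  assumes "c \<in> extensional (tuples q X)" "d \<in> extensional (tuples q X)"
  shows "as_class q X c \<oplus>\<^bsub>as_cochains q X\<^esub> as_class q X d = as_class q X (\<lambda>xs\<in>tuples q X. c xs + d xs)"
  using scaled_subgroup.quot_add[OF scaled_subgroup_locally_zero, of c q X d] assms
  by (simp add: as_class_def as_cochains_def)

lemma as_class_zero_iff:
  assumes "c \<in> extensional (tuples q X)"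
  shows "as_class q X c = \<zero>\<^bsub>as_cochains q X\<^esub> \<longleftrightarrow> c \<in> locally_zero q X"
  unfolding as_class_def as_cochains_def
  using scaled_subgroup.coset_eq_zero_iff[OF scaled_subgroup_locally_zero, of c q X] assms by simp

lemma coboundary_image: "coboundary q X ` locally_zero q X \<subseteq> (locally_zero (Suc q) X :: ('a list \<Rightarrow> 'k::field) set)"
  using locally_zero_imp_cobounds[of _ q X] cobounds_imp_cocycle[of q X]
  by (force simp: coboundary_locally_zero)

lemma as_coboundary_class:
  "c \<in> extensional (tuples q X) \<Longrightarrow> as_coboundary q X (as_class q X c) = as_class (Suc q) X (coboundary q X c)"
  unfolding as_coboundary_def as_class_def
  by (rule quot_map_coset[OF scaled_subgroup_locally_zero scaled_subgroup_locally_zero coboundary_linear coboundary_image]) simp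

lemma as_coboundary_linear:
  "as_coboundary q X \<in> linear_map (as_cochains q X :: ('k::field, ('a list \<Rightarrow> 'k) set) module) (as_cochains (Suc q) X)"
  unfolding as_coboundary_def as_cochains_def
  by (rule quot_map_linear[OF scaled_subgroup_locally_zero scaled_subgroup_locally_zero coboundary_linear coboundary_image])

lemma as_pullback_class:
  "continuous_map X Y f \<Longrightarrow> c \<in> extensional (tuples q Y) \<Longrightarrow> as_pullback q X f (as_class q Y c) = as_class q X (pullback q X f c)"
  unfolding as_pullback_def as_class_def
  by (rule quot_map_coset[OF scaled_subgroup_locally_zero scaled_subgroup_locally_zero pullback_linear pullback_locally_zero]) simp_all

lemma as_pullback_linear:
  "continuous_map X Y f \<Longrightarrow> as_pullback q X f \<in> linear_map (as_cochains q Y :: ('k::field, ('b list \<Rightarrow> 'k) set) module) (as_cochains q X)"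
  unfolding as_pullback_def as_cochains_def
  by (rule quot_map_linear[OF scaled_subgroup_locally_zero scaled_subgroup_locally_zero pullback_linear pullback_locally_zero])

lemma as_class_cocycle_iff:
  assumes "c \<in> extensional (tuples q X)"
  shows "as_class q X c \<in> carrier (as_cocycles q X) \<longleftrightarrow> cocycle q X c"
proof -
  have "coboundary q X c \<in> extensional (tuples (Suc q) X)" by (simp add: coboundary_def)
  then show ?thesis
    using assms by (simp add: as_cocycles_def as_class_carrier as_coboundary_class as_class_zero_iff coboundary_locally_zero)
qed

lemma as_cocycles_carrierE:
  assumes "A \<in> carrier (as_cocycles q X)"
  obtains c where "c \<in> extensional (tuples q X)" "A = as_class q X c" "cocycle q X c"
proof -
  have "A \<in> carrier (as_cochains q X)" using assms by (simp add: as_cocycles_def)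
  then obtain c where "c \<in> extensional (tuples q X)" "A = as_class q X c" by (rule as_cochains_carrierE)
  then show thesis using assms as_class_cocycle_iff by (intro that) blast+
qed

lemma as_class_coboundary_iff:
  fixes c :: "'a list \<Rightarrow> 'k::field"
  assumes c: "c \<in> extensional (tuples q X)"
  shows "as_class q X c \<in> as_coboundaries q X \<longleftrightarrow> cobounds q X c"
proof (cases q)
  case 0
  have "cobounds 0 X c \<longleftrightarrow> for_small X (\<lambda>xs. length xs = Suc 0 \<longrightarrow> c xs = 0)"
  proof
    assume "cobounds 0 X c"
    then obtain b where b: "b [] = 0" "for_small X (\<lambda>xs. length xs = Suc 0 \<longrightarrow> c xs = codiff b xs)"
      unfolding cobounds_def by blast
    show "for_small X (\<lambda>xs. length xs = Suc 0 \<longrightarrow> c xs = 0)"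
      by (rule for_small_mono[OF b(2)]) (auto simp: length_Suc_conv b(1))
  next
    assume "for_small X (\<lambda>xs. length xs = Suc 0 \<longrightarrow> c xs = 0)"
    then show "cobounds 0 X c"
      unfolding cobounds_def by (intro exI[of _ "\<lambda>_. 0"]) (simp add: codiff_eq_sum)
  qed
  then show ?thesis
    using c 0 by (simp add: as_coboundaries_def as_class_zero_iff locally_zero_iff)
next
  case (Suc r)
  have "as_class q X c \<in> as_coboundaries q X \<longleftrightarrow>
      (\<exists>d\<in>extensional (tuples r X). as_class q X c = as_class q X (coboundary r X d))"
  proof
    assume "as_class q X c \<in> as_coboundaries q X"
    then obtain A where "A \<in> carrier (as_cochains r X)" "as_class q X c = as_coboundary r X A"
      unfolding as_coboundaries_def Suc by auto
    then show "\<exists>d\<in>extensional (tuples r X). as_class q X c = as_class q X (coboundary r X d)"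
      using as_coboundary_class Suc by (metis as_cochains_carrierE)
  next
    assume "\<exists>d\<in>extensional (tuples r X). as_class q X c = as_class q X (coboundary r X d)"
    then obtain d where d: "d \<in> extensional (tuples r X)" "as_class q X c = as_coboundary r X (as_class r X d)"
      using as_coboundary_class Suc by metis
    then show "as_class q X c \<in> as_coboundaries q X"
      unfolding as_coboundaries_def Suc using as_class_carrier[OF d(1)] by simp
  qed
  also have "\<dots> \<longleftrightarrow> (\<exists>d\<in>extensional (tuples r X). for_small X (\<lambda>xs. length xs = Suc q \<longrightarrow> c xs = codiff d xs))"
  proof (rule bex_cong[OF refl])
    fix d :: "'a list \<Rightarrow> 'k" assume "d \<in> extensional (tuples r X)"
    have "coboundary r X d \<in> extensional (tuples q X)" by (simp add: coboundary_def Suc)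
    from as_class_eq_iff[OF c this]
    show "as_class q X c = as_class q X (coboundary r X d) \<longleftrightarrow> for_small X (\<lambda>xs. length xs = Suc q \<longrightarrow> c xs = codiff d xs)"
      by (auto simp: Suc coboundary_eq_codiff tuplesI elim!: for_small_mono)
  qed
  also have "\<dots> \<longleftrightarrow> cobounds q X c"
  proof
    assume "\<exists>d\<in>extensional (tuples r X). for_small X (\<lambda>xs. length xs = Suc q \<longrightarrow> c xs = codiff d xs)"
    then obtain d where d: "for_small X (\<lambda>xs. length xs = Suc q \<longrightarrow> c xs = codiff d xs)" by blast
    have "codiff (d([] := 0)) xs = codiff d xs" if "length xs = Suc q" for xs
      by (rule codiff_cong) (use that Suc in auto)
    then have "for_small X (\<lambda>xs. length xs = Suc q \<longrightarrow> c xs = codiff (d([] := 0)) xs)"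
      by (intro for_small_mono[OF d]) simp
    then show "cobounds q X c" unfolding cobounds_def by (intro exI[of _ "d([] := 0)"]) simp
  next
    assume "cobounds q X c"
    then obtain b where b: "for_small X (\<lambda>xs. length xs = Suc q \<longrightarrow> c xs = codiff b xs)"
      unfolding cobounds_def by blast
    have "for_small X (\<lambda>xs. length xs = Suc q \<longrightarrow> c xs = codiff (restrict b (tuples r X)) xs)"
      by (rule for_small_mono[OF b]) (simp add: codiff_restrict tuplesI Suc)
    then show "\<exists>d\<in>extensional (tuples r X). for_small X (\<lambda>xs. length xs = Suc q \<longrightarrow> c xs = codiff d xs)"
      by (intro bexI[of _ "restrict b (tuples r X)"]) auto
  qed
  finally show ?thesis .
qed

lemma as_cocycles_subgroup:
  "scaled_subgroup (carrier (as_cocycles q X)) (as_cochains q X :: ('k::field, ('a list \<Rightarrow> 'k) set) module)"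
  using kernel_scaled_subgroup[OF as_cochains_scaled_group scaled_subgroup_zero[OF as_cochains_scaled_group] as_coboundary_linear]
  by (simp add: as_cocycles_def)

lemma as_cocycles_eq: "as_cocycles q X = (as_cochains q X)\<lparr>carrier := carrier (as_cocycles q X)\<rparr>"
  by (simp add: as_cocycles_def)

lemma as_coboundaries_subgroup:
  "scaled_subgroup (as_coboundaries q X) (as_cocycles q X :: ('k::field, ('a list \<Rightarrow> 'k) set) module)"
proof -
  have "scaled_subgroup (as_coboundaries q X) (as_cochains q X :: ('k, ('a list \<Rightarrow> 'k) set) module)"
  proof (cases q)
    case 0
    then show ?thesis using scaled_subgroup_zero[OF as_cochains_scaled_group] by (simp add: as_coboundaries_def)
  next
    case (Suc r)
    then show ?thesis
      using image_scaled_subgroup[OF as_cochains_scaled_group as_cochains_scaled_group as_coboundary_linear]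
      by (simp add: as_coboundaries_def)
  qed
  moreover have "as_coboundaries q X \<subseteq> carrier (as_cocycles q X :: ('k, ('a list \<Rightarrow> 'k) set) module)"
  proof
    fix A :: "('a list \<Rightarrow> 'k) set" assume A: "A \<in> as_coboundaries q X"
    have "A \<in> carrier (as_cochains q X)"
      using A additive_subgroup.a_subset[OF scaled_subgroup.axioms(2)[OF calculation]] by blast
    then obtain c where "c \<in> extensional (tuples q X)" "A = as_class q X c" by (rule as_cochains_carrierE)
    then show "A \<in> carrier (as_cocycles q X)"
      using A by (simp add: as_class_coboundary_iff as_class_cocycle_iff cobounds_imp_cocycle)
  qed
  ultimately show ?thesis
    by (subst as_cocycles_eq) (rule scaled_subgroup_of_subspace[OF as_cocycles_subgroup])
qed

text \<open>
  Both levels of quotients are unfolded here once and for all: what remains to be shown for an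
  induced map to be bijective concerns arbitrary functions on lists.
\<close>
theorem cech_induced_linear_iso:
  fixes X :: "'a topology" and Y :: "'b topology"
  assumes f: "continuous_map X Y f"
    and inj: "\<And>c :: 'b list \<Rightarrow> 'k::field. cocycle q Y c \<Longrightarrow> cobounds q X (\<lambda>xs. c (map f xs)) \<Longrightarrow> cobounds q Y c"
    and surj: "\<And>c :: 'a list \<Rightarrow> 'k. cocycle q X c \<Longrightarrow>
       \<exists>c'. cocycle q Y c' \<and> cobounds q X (\<lambda>xs. c xs - c' (map f xs))"
  shows "(cech_induced q X f :: ('b list \<Rightarrow> 'k) set set \<Rightarrow> _) \<in> linear_iso (cech_cohomology q Y) (cech_cohomology q X)"
  unfolding cech_induced_def cech_cohomology_def
proof (rule quot_map_linear_iso)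
  have pb_ext: "pullback q X f c \<in> extensional (tuples q X)" for c :: "'b list \<Rightarrow> 'k"
    by (simp add: pullback_def)
  have pb_cobounds: "cobounds q X (pullback q X f c) \<longleftrightarrow> cobounds q X (\<lambda>xs. c (map f xs))" for c :: "'b list \<Rightarrow> 'k"
    by (rule iffI; erule cobounds_cong) (simp_all add: pullback_apply tuplesI)
  show "scaled_subgroup (as_coboundaries q Y) (as_cocycles q Y :: ('k, ('b list \<Rightarrow> 'k) set) module)"
    by (rule as_coboundaries_subgroup)
  show "scaled_subgroup (as_coboundaries q X) (as_cocycles q X :: ('k, ('a list \<Rightarrow> 'k) set) module)"
    by (rule as_coboundaries_subgroup)
  show "(as_pullback q X f :: ('b list \<Rightarrow> 'k) set \<Rightarrow> _) \<in> linear_map (as_cocycles q Y) (as_cocycles q X)"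
  proof -
    have "as_pullback q X f A \<in> carrier (as_cocycles q X)" if "A \<in> carrier (as_cocycles q Y)" for A :: "('b list \<Rightarrow> 'k) set"
      using that by (auto elim!: as_cocycles_carrierE
          simp: as_pullback_class[OF f] as_class_cocycle_iff pb_ext pullback_cocycle[OF f])
    then show ?thesis
      using as_pullback_linear[OF f, of q, where 'k='k]
      by (auto simp: linear_map_def as_cocycles_def)
  qed
  show "as_pullback q X f ` as_coboundaries q Y \<subseteq> (as_coboundaries q X :: ('a list \<Rightarrow> 'k) set set)"
  proof clarify
    fix A :: "('b list \<Rightarrow> 'k) set" assume A: "A \<in> as_coboundaries q Y"
    then have "A \<in> carrier (as_cocycles q Y)"
      using additive_subgroup.a_subset[OF scaled_subgroup.axioms(2)[OF as_coboundaries_subgroup]] by blast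
    then obtain c where c: "c \<in> extensional (tuples q Y)" "A = as_class q Y c" by (rule as_cocycles_carrierE)
    then show "as_pullback q X f A \<in> as_coboundaries q X"
      using A pullback_cobounds[OF f, of q c]
      by (simp add: as_pullback_class[OF f] as_class_coboundary_iff pb_ext pb_cobounds)
  qed
  show "A \<in> as_coboundaries q Y" if A: "A \<in> carrier (as_cocycles q Y)" "as_pullback q X f A \<in> as_coboundaries q X"
    for A :: "('b list \<Rightarrow> 'k) set"
  proof -
    obtain c where c: "c \<in> extensional (tuples q Y)" "A = as_class q Y c" "cocycle q Y c"
      using A(1) by (rule as_cocycles_carrierE)
    then show ?thesis
      using A(2) inj[OF c(3)] by (simp add: as_pullback_class[OF f] as_class_coboundary_iff pb_ext pb_cobounds)
  qed
  show "\<exists>A\<in>carrier (as_cocycles q Y). \<exists>C\<in>as_coboundaries q X. B = C \<oplus>\<^bsub>as_cocycles q X\<^esub> as_pullback q X f A"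
    if B: "B \<in> carrier (as_cocycles q X)" for B :: "('a list \<Rightarrow> 'k) set"
  proof -
    obtain c where c: "c \<in> extensional (tuples q X)" "B = as_class q X c" "cocycle q X c"
      using B by (rule as_cocycles_carrierE)
    obtain c' where c': "cocycle q Y c'" "cobounds q X (\<lambda>xs. c xs - c' (map f xs))"
      using surj[OF c(3)] by blast
    define e where "e = restrict c' (tuples q Y)"
    define d where "d = (\<lambda>xs\<in>tuples q X. c xs - c' (map f xs))"
    have e: "e \<in> extensional (tuples q Y)" by (simp add: e_def)
    have "cocycle q Y e"
      unfolding cocycle_def e_def
      by (rule for_small_mono[OF c'(1)[unfolded cocycle_def]]) (simp add: codiff_restrict tuplesI)
    then have eZ: "as_class q Y e \<in> carrier (as_cocycles q Y)" using e by (simp add: as_class_cocycle_iff)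
    have "cobounds q X d" by (rule cobounds_cong[OF c'(2)]) (simp add: d_def tuplesI)
    then have dB: "as_class q X d \<in> as_coboundaries q X" by (simp add: d_def as_class_coboundary_iff)
    have "(\<lambda>xs\<in>tuples q X. d xs + pullback q X f e xs) = c"
      using c(1) map_tuples[OF f]
      by (auto simp: fun_eq_iff d_def e_def pullback_def extensional_def restrict_def)
    then have "as_class q X d \<oplus>\<^bsub>as_cochains q X\<^esub> as_class q X (pullback q X f e) = B"
      using pb_ext by (subst as_class_add) (simp_all add: d_def c(2))
    then have "B = as_class q X d \<oplus>\<^bsub>as_cocycles q X\<^esub> as_pullback q X f (as_class q Y e)"
      by (simp add: as_pullback_class[OF f e] as_cocycles_def)
    then show ?thesis using eZ dB by blast
  qed
qed

section \<open>Majorants on paracompact Hausdorff spaces\<close>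

lemma locally_finite_refinement:
  assumes "paracompact_space X" "open_cover X \<U>"
  obtains \<V> where "open_cover X \<V>" "\<forall>V\<in>\<V>. \<exists>U\<in>\<U>. V \<subseteq> U" "locally_finite_in X \<V>"
  using assms(1)[unfolded paracompact_space_def, rule_format, OF assms(2)] by (elim exE conjE)

text \<open>
  Local separation can be made global: in a locally finite refinement, take all the members that
  meet \<open>C\<close>; the closure of their union is the union of their closures. With \<open>A\<close> a point this
  yields regularity, and then with \<open>A\<close> closed it yields normality.
\<close>
lemma paracompact_separation:
  assumes para: "paracompact_space X" and C: "closedin X C"
    and sep: "\<And>x. x \<in> C \<Longrightarrow> \<exists>U. openin X U \<and> x \<in> U \<and> disjnt A (X closure_of U)"
  obtains G where "openin X G" "C \<subseteq> G" "disjnt A (X closure_of G)"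
proof -
  define \<U> where "\<U> = insert (topspace X - C) {U. openin X U \<and> disjnt A (X closure_of U)}"
  have "topspace X \<subseteq> \<Union>\<U>" using sep by (fastforce simp: \<U>_def)
  moreover have op: "openin X U" if "U \<in> \<U>" for U using that C by (auto simp: \<U>_def)
  ultimately have U: "open_cover X \<U>"
    using openin_subset unfolding open_cover_def by (metis Sup_least subset_antisym)
  obtain \<V> where V: "open_cover X \<V>" "\<forall>V\<in>\<V>. \<exists>U\<in>\<U>. V \<subseteq> U" "locally_finite_in X \<V>"
    by (rule locally_finite_refinement[OF para U])
  define \<V>' where "\<V>' = {V \<in> \<V>. V \<inter> C \<noteq> {}}"
  have "locally_finite_in X \<V>'"
    by (rule locally_finite_in_subset[OF V(3)]) (auto simp: \<V>'_def)
  then have cl: "X closure_of (\<Union>\<V>') = (\<Union>V\<in>\<V>'. X closure_of V)"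
    by (rule closure_of_locally_finite_Union)
  have "disjnt A (X closure_of V)" if V': "V \<in> \<V>'" for V
  proof -
    have "V \<in> \<V>" using V' by (simp add: \<V>'_def)
    with V(2) obtain U where U: "U \<in> \<U>" "V \<subseteq> U" by blast
    have "U \<noteq> topspace X - C" using V' U by (auto simp: \<V>'_def)
    then have "disjnt A (X closure_of U)" using U by (auto simp: \<U>_def)
    then show ?thesis using closure_of_mono[OF U(2)] by (meson disjnt_subset2)
  qed
  then have "disjnt A (X closure_of (\<Union>\<V>'))" unfolding cl by (auto simp: disjnt_iff)
  moreover have "openin X (\<Union>\<V>')" using V(1) by (auto simp: \<V>'_def open_cover_def)
  moreover have "C \<subseteq> \<Union>\<V>'"
  proof
    fix x assume x: "x \<in> C"
    then have "x \<in> \<Union>\<V>" using V(1) closedin_subset[OF C] by (auto simp: open_cover_def)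
    then show "x \<in> \<Union>\<V>'" using x by (auto simp: \<V>'_def)
  qed
  ultimately show thesis using that by blast
qed

lemma paracompact_Hausdorff_imp_regular_space:
  assumes "paracompact_space X" "Hausdorff_space X"
  shows "regular_space X"
  unfolding regular_space_def
proof (intro allI impI)
  fix C a assume Ca: "closedin X C \<and> a \<in> topspace X - C"
  have "\<exists>U. openin X U \<and> x \<in> U \<and> disjnt {a} (X closure_of U)" if "x \<in> C" for x
  proof -
    have "x \<in> topspace X" "a \<in> topspace X" "x \<noteq> a" using that Ca closedin_subset by auto
    then obtain U V where UV: "openin X U" "openin X V" "x \<in> U" "a \<in> V" "disjnt U V"
      using assms(2) unfolding Hausdorff_space_def by meson
    then have "V \<inter> X closure_of U = {}"
      using openin_Int_closure_of_eq_empty[OF UV(2), of U] by (auto simp: disjnt_def)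
    then show ?thesis using UV by auto
  qed
  then obtain G where G: "openin X G" "C \<subseteq> G" "disjnt {a} (X closure_of G)"
    by (rule paracompact_separation[OF assms(1) conjunct1[OF Ca]])
  have "disjnt (topspace X - X closure_of G) G"
    using closure_of_subset[OF openin_subset[OF G(1)]] by (auto simp: disjnt_iff)
  then show "\<exists>U V. openin X U \<and> openin X V \<and> a \<in> U \<and> C \<subseteq> V \<and> disjnt U V"
    using G Ca by (intro exI[of _ "topspace X - X closure_of G"] exI[of _ G]) auto
qed

lemma paracompact_Hausdorff_imp_normal_space:
  assumes "paracompact_space X" "Hausdorff_space X"
  shows "normal_space X"
  unfolding normal_space_def
proof (intro allI impI)
  fix A C assume "closedin X A \<and> closedin X C \<and> disjnt A C"
  then have AC: "closedin X A" "closedin X C" "disjnt A C" by auto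
  have "\<exists>U. openin X U \<and> x \<in> U \<and> disjnt A (X closure_of U)" if "x \<in> C" for x
  proof -
    have "x \<in> topspace X - A" using that AC closedin_subset by (auto simp: disjnt_iff)
    then show ?thesis
      using paracompact_Hausdorff_imp_regular_space[OF assms] AC unfolding regular_space by blast
  qed
  then obtain G where G: "openin X G" "C \<subseteq> G" "disjnt A (X closure_of G)"
    by (rule paracompact_separation[OF assms(1) AC(2)])
  have "disjnt (topspace X - X closure_of G) G"
    using closure_of_subset[OF openin_subset[OF G(1)]] by (auto simp: disjnt_iff)
  moreover have "A \<subseteq> topspace X - X closure_of G"
    using G(3) closedin_subset[OF AC(1)] by (auto simp: disjnt_iff)
  ultimately show "\<exists>U V. openin X U \<and> openin X V \<and> A \<subseteq> U \<and> C \<subseteq> V \<and> disjnt U V"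
    using G by (intro exI[of _ "topspace X - X closure_of G"] exI[of _ G]) auto
qed

text \<open>
  A locally bounded requirement on a real parameter can be met by a continuous choice. Let \<open>B n\<close>
  be the open set on which \<open>n\<close> is locally good enough. Regularity and paracompactness give closed
  sets \<open>F n \<subseteq> B n\<close>, increasing in \<open>n\<close>, whose interiors cover the space. Let \<open>g n\<close> be a
  Urysohn function that is \<open>0\<close> on \<open>F n\<close> and \<open>1\<close> off \<open>B n\<close>. Their sum is locally finite, and
  at \<open>x\<close> it is at least the number of all \<open>n\<close> with \<open>x \<notin> B n\<close>, hence large enough.
\<close>
lemma continuous_majorant:
  fixes R :: "'a \<Rightarrow> real \<Rightarrow> bool"
  assumes para: "paracompact_space X" and haus: "Hausdorff_space X"
    and mono: "\<And>x s t. R x s \<Longrightarrow> s \<le> t \<Longrightarrow> R x t"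
    and loc: "\<And>x. x \<in> topspace X \<Longrightarrow> \<exists>U n. openin X U \<and> x \<in> U \<and> (\<forall>y\<in>U. R y (real n))"
  obtains f where "continuous_map X euclideanreal f" "\<And>x. x \<in> topspace X \<Longrightarrow> 0 \<le> f x"
    "\<And>x. x \<in> topspace X \<Longrightarrow> R x (f x)"
proof -
  define B where "B n = \<Union>{U. openin X U \<and> (\<forall>y\<in>U. R y (real n))}" for n :: nat
  have B_open: "openin X (B n)" for n unfolding B_def by blast
  have B_R: "R x (real n)" if "x \<in> B n" for x n using that unfolding B_def by blast
  have B_mono: "B m \<subseteq> B n" if "m \<le> n" for m n
  proof -
    have "R y (real n)" if "R y (real m)" for y
      using mono[OF that] \<open>m \<le> n\<close> by simp
    then show ?thesis unfolding B_def by blast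
  qed
  define \<W> where "\<W> = {W. openin X W \<and> (\<exists>n. X closure_of W \<subseteq> B n)}"
  have "topspace X \<subseteq> \<Union>\<W>"
  proof
    fix x assume x: "x \<in> topspace X"
    obtain n where n: "x \<in> B n" using loc[OF x] unfolding B_def by blast
    have "closedin X (topspace X - B n)" "x \<in> topspace X - (topspace X - B n)"
      using B_open n x by auto
    then obtain W where W: "openin X W" "x \<in> W" "disjnt (topspace X - B n) (X closure_of W)"
      using paracompact_Hausdorff_imp_regular_space[OF para haus] unfolding regular_space by blast
    then have "X closure_of W \<subseteq> B n"
      using closure_of_subset_topspace[of X W] by (auto simp: disjnt_iff)
    then show "x \<in> \<Union>\<W>" using W unfolding \<W>_def by blast
  qed
  then have W: "open_cover X \<W>"
    using openin_subset[of X] by (auto simp: open_cover_def \<W>_def)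
  obtain \<V> where V: "open_cover X \<V>" "\<forall>V\<in>\<V>. \<exists>U\<in>\<W>. V \<subseteq> U" "locally_finite_in X \<V>"
    by (rule locally_finite_refinement[OF para W])
  have "\<exists>n. X closure_of V \<subseteq> B n" if "V \<in> \<V>" for V
  proof -
    from V(2) \<open>V \<in> \<V>\<close> obtain W n where "V \<subseteq> W" "X closure_of W \<subseteq> B n"
      unfolding \<W>_def by blast
    then show ?thesis using closure_of_mono[of V W X] by blast
  qed
  then obtain level where level: "\<And>V. V \<in> \<V> \<Longrightarrow> X closure_of V \<subseteq> B (level V)" by metis
  define F where "F n = (\<Union>V\<in>{V\<in>\<V>. level V \<le> n}. X closure_of V)" for n
  have F_closed: "closedin X (F n)" for n
    unfolding F_def
    by (rule closedin_Union_locally_finite_closure, rule locally_finite_in_subset[OF V(3)]) auto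
  have F_B: "F n \<subseteq> B n" for n
    using level B_mono unfolding F_def by fastforce
  have V_F: "V \<subseteq> F n" if "V \<in> \<V>" "level V \<le> n" for V n
  proof -
    have "V \<subseteq> X closure_of V"
      using V(1) that by (intro closure_of_subset openin_subset) (auto simp: open_cover_def)
    then show ?thesis using that by (auto simp: F_def)
  qed
  have "\<exists>g. continuous_map X (top_of_set {0..1::real}) g \<and> g ` F n \<subseteq> {0} \<and> g ` (topspace X - B n) \<subseteq> {1}" for n
  proof -
    have "closedin X (topspace X - B n)" "disjnt (F n) (topspace X - B n)"
      using B_open F_B[of n] by (auto simp: disjnt_iff)
    then obtain g where "continuous_map X (top_of_set {0..1::real}) g" "g ` F n \<subseteq> {0}"
      "g ` (topspace X - B n) \<subseteq> {1}"
      by (rule Urysohn_lemma[OF paracompact_Hausdorff_imp_normal_space[OF para haus] F_closed[of n] _ _ zero_le_one])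
    then show ?thesis by blast
  qed
  then obtain g where g: "\<And>n. continuous_map X (top_of_set {0..1::real}) (g n)"
    "\<And>n. g n ` F n \<subseteq> {0}" "\<And>n. g n ` (topspace X - B n) \<subseteq> {1}" by metis
  have g_cont: "continuous_map X euclideanreal (g n)" for n
    using g(1)[of n] by (simp add: continuous_map_in_subtopology)
  have g_nonneg: "0 \<le> g n x" if "x \<in> topspace X" for n x
    using g(1)[of n] that by (auto simp: continuous_map_in_subtopology Pi_iff)
  have g0: "g n x = 0" if "x \<in> V" "V \<in> \<V>" "level V \<le> n" for n x V
    using V_F[OF that(2,3)] that(1) g(2)[of n] by blast
  obtain f where f: "continuous_map X euclideanreal f"
    "\<And>x V. V \<in> \<V> \<Longrightarrow> x \<in> topspace X \<inter> V \<Longrightarrow> f x = (\<Sum>n<level V. g n x)"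
  proof (rule pasting_lemma_exists[where I=\<V> and T="\<lambda>V. V" and X=X and Y=euclideanreal and f="\<lambda>V x. \<Sum>n<level V. g n x"])
    show "topspace X \<subseteq> (\<Union>V\<in>\<V>. V)" "\<And>V. V \<in> \<V> \<Longrightarrow> openin X V" using V(1) by (auto simp: open_cover_def)
    show "continuous_map (subtopology X V) euclideanreal (\<lambda>x. \<Sum>n<level V. g n x)" for V
      by (intro continuous_map_sum continuous_map_from_subtopology g_cont) simp
    show "(\<Sum>n<level V. g n x) = (\<Sum>n<level W. g n x)"
      if "V \<in> \<V>" "W \<in> \<V>" "x \<in> topspace X \<inter> V \<inter> W" for V W x
    proof -
      have "(\<Sum>n<level V. g n x) = (\<Sum>n<min (level V) (level W). g n x)"
        by (rule sum.mono_neutral_right) (use that in \<open>auto intro!: g0[of x W]\<close>)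
      also have "\<dots> = (\<Sum>n<level W. g n x)"
        by (rule sum.mono_neutral_left) (use that in \<open>auto intro!: g0[of x V]\<close>)
      finally show ?thesis .
    qed
  qed blast
  show thesis
  proof (rule that[OF f(1)])
    fix x assume x: "x \<in> topspace X"
    then have "x \<in> \<Union>\<V>" using V(1) by (simp add: open_cover_def)
    then obtain V where V': "V \<in> \<V>" "x \<in> V" by (rule UnionE)
    have fx: "f x = (\<Sum>n<level V. g n x)" using f(2) V' x by blast
    then show "0 \<le> f x" using g_nonneg[OF x] by (simp add: sum_nonneg)
    have xB: "x \<in> B (level V)" using V' V_F F_B by blast
    \<comment> \<open>Each \<open>n < N\<close> contributes \<open>1\<close> to the sum at \<open>x\<close>.\<close>
    define N where "N = (LEAST n. x \<in> B n)"
    have N: "x \<in> B N" unfolding N_def using xB by (rule LeastI)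
    have "N \<le> level V" unfolding N_def using xB by (rule Least_le)
    have "real N = (\<Sum>n<N. g n x)"
    proof -
      have "g n x = 1" if "n < N" for n
      proof -
        have "x \<notin> B n" using that unfolding N_def by (rule not_less_Least)
        then show ?thesis using g(3)[of n] x by blast
      qed
      then show ?thesis by simp
    qed
    also have "\<dots> \<le> f x"
      unfolding fx using \<open>N \<le> level V\<close> g_nonneg[OF x] by (intro sum_mono2) auto
    finally show "R x (f x)" using mono[OF B_R[OF N]] by blast
  qed
qed

lemma compact_imp_paracompact_space:
  assumes "compact_space X" shows "paracompact_space X"
  unfolding paracompact_space_def
proof (intro allI impI)
  fix \<U> assume U: "open_cover X \<U>"
  then obtain \<F> where F: "finite \<F>" "\<F> \<subseteq> \<U>" "topspace X \<subseteq> \<Union>\<F>"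
    using assms unfolding compact_space_alt open_cover_def by (metis order_refl)
  have "\<Union>\<F> \<subseteq> \<Union>\<U>" using F(2) by (rule Union_mono)
  then have "\<Union>\<F> = topspace X" using F(3) U by (simp add: open_cover_def)
  then show "\<exists>\<V>. open_cover X \<V> \<and> (\<forall>V\<in>\<V>. \<exists>U\<in>\<U>. V \<subseteq> U) \<and> locally_finite_in X \<V>"
    using U F by (intro exI[of _ \<F>] conjI finite_imp_locally_finite_in) (auto simp: open_cover_def)
qed

section \<open>Homotopy invariance\<close>

text \<open>
  The homotopy operator is the sum of the prisms between \<open>g k\<close> and \<open>g (Suc k)\<close>. A prism between
  two equal maps need not vanish, so the constant prism from \<open>r\<close> to \<open>r\<close> is subtracted from every
  term. This makes the sum finite at each tuple, and it does not change the coboundary because the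
  constant prism of a cocycle is itself a cocycle.
\<close>
lemma telescoping_homotopy:
  fixes c :: "'b list \<Rightarrow> 'k::field" and g :: "nat \<Rightarrow> 'a \<Rightarrow> 'b"
  assumes stat: "\<And>x. x \<in> topspace X \<Longrightarrow> \<exists>n. \<forall>k\<ge>n. g k x = r x"
    and U: "\<And>U ys. U \<in> \<U> \<Longrightarrow> set ys \<subseteq> U \<Longrightarrow> length ys = Suc (Suc q) \<Longrightarrow> codiff c ys = 0"
    and small: "for_small X (\<lambda>xs. \<forall>k. \<exists>U\<in>\<U>. g k ` set xs \<union> g (Suc k) ` set xs \<subseteq> U)"
  shows "cobounds q X (\<lambda>xs. c (map r xs) - c (map (g 0) xs))"
proof -
  obtain n where n: "\<And>x k. x \<in> topspace X \<Longrightarrow> n x \<le> k \<Longrightarrow> g k x = r x"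
    using stat by metis
  define m where "m xs = Max (insert 0 (n ` set xs))" for xs
  have m: "g k y = r y" if "set xs \<subseteq> topspace X" "y \<in> set xs" "m xs \<le> k" for xs k y
    using that n[of y k] by (auto simp: m_def)
  have mono: "m ys \<le> m xs" if "set ys \<subseteq> set xs" for ys xs
    unfolding m_def using that by (intro Max_mono) auto
  \<comment> \<open>Vanishes at a tuple as soon as all its points are stationary.\<close>
  define t where "t k ys = prism (g k) (g (Suc k)) c ys - prism r r c ys" for k ys
  define b where "b ys = (\<Sum>k<m ys. t k ys)" for ys
  have t0: "t k ys = 0" if "set ys \<subseteq> topspace X" "m ys \<le> k" for k ys
    using that m[of ys _ k] m[of ys _ "Suc k"] prism_cong[of ys "g k" r "g (Suc k)" r c]
    by (auto simp: t_def)
  have b_eq: "b ys = (\<Sum>k<j. t k ys)" if "set ys \<subseteq> topspace X" "m ys \<le> j" for ys j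
    unfolding b_def using that by (intro sum.mono_neutral_left) (auto intro: t0)
  have "codiff b xs = c (map r xs) - c (map (g 0) xs)"
    if top: "set xs \<subseteq> topspace X" and len: "length xs = Suc q"
      and sm: "\<forall>k. \<exists>U\<in>\<U>. g k ` set xs \<union> g (Suc k) ` set xs \<subseteq> U" for xs
  proof -
    have vanish: "prism (g k) (g (Suc k)) (codiff c) xs = 0" for k
      by (rule prism_eq_0) (use sm U len in \<open>metis subset_trans\<close>)
    have "prism r r (codiff c) xs = prism (g (m xs)) (g (Suc (m xs))) (codiff c) xs"
      by (rule prism_cong) (use m[OF top] in auto)
    then have dr: "codiff (prism r r c) xs = 0"
      using prism_homotopy[of r r c xs] vanish by simp
    have dt: "codiff (t k) xs = c (map (g (Suc k)) xs) - c (map (g k) xs)" for k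
      using prism_homotopy[of "g k" "g (Suc k)" c xs] vanish dr
      unfolding t_def by (simp add: codiff_diff)
    have "codiff b xs = codiff (\<lambda>ys. \<Sum>k<m xs. t k ys) xs"
      by (rule codiff_cong) (use top in \<open>auto intro!: b_eq mono\<close>)
    also have "\<dots> = (\<Sum>k<m xs. c (map (g (Suc k)) xs) - c (map (g k) xs))"
      by (simp add: codiff_sum dt)
    also have "\<dots> = c (map (g (m xs)) xs) - c (map (g 0) xs)"
      by (rule sum_lessThan_telescope)
    also have "map (g (m xs)) xs = map r xs" using m[OF top] by auto
    finally show ?thesis .
  qed
  moreover have "b [] = 0" by (simp add: b_def t_def)
  ultimately show ?thesis unfolding cobounds_def
    by (intro exI[of _ b] conjI for_small_mono[OF small]) auto
qed

text \<open>A homotopy with a single step.\<close>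
lemma contiguous_maps:
  fixes c :: "'b list \<Rightarrow> 'k::field" and g h :: "'a \<Rightarrow> 'b"
  assumes U: "\<And>U ys. U \<in> \<U> \<Longrightarrow> set ys \<subseteq> U \<Longrightarrow> length ys = Suc (Suc q) \<Longrightarrow> codiff c ys = 0"
    and small: "for_small X (\<lambda>xs. \<exists>U\<in>\<U>. g ` set xs \<union> h ` set xs \<subseteq> U)"
  shows "cobounds q X (\<lambda>xs. c (map h xs) - c (map g xs))"
proof -
  define s where "s k = (if k = 0 then g else h)" for k :: nat
  have "cobounds q X (\<lambda>xs. c (map h xs) - c (map (s 0) xs))"
  proof (rule telescoping_homotopy[OF _ U])
    show "\<exists>n. \<forall>k\<ge>n. s k x = h x" for x by (intro exI[of _ 1]) (simp add: s_def)
    show "for_small X (\<lambda>xs. \<forall>k. \<exists>U\<in>\<U>. s k ` set xs \<union> s (Suc k) ` set xs \<subseteq> U)"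
      by (rule for_small_mono[OF small]) (auto simp: s_def)
  qed
  then show ?thesis by (simp add: s_def)
qed

text \<open>
  A Lebesgue number for the homotopy at \<open>x\<close> that depends continuously on \<open>x\<close>, written as
  \<open>1 / (1 + f x)\<close>. Near each point a constant number works because the unit interval is compact.
\<close>
lemma homotopy_mesh:
  assumes "paracompact_space X" "Hausdorff_space X"
    and h: "continuous_map (prod_topology (top_of_set {0..1::real}) X) Y h"
    and \<U>: "open_cover Y \<U>"
  obtains f where "continuous_map X euclideanreal f" "\<And>x. x \<in> topspace X \<Longrightarrow> 0 \<le> f x"
    "\<And>x s t. x \<in> topspace X \<Longrightarrow> s \<in> {0..1} \<Longrightarrow> t \<in> {0..1} \<Longrightarrow> \<bar>s - t\<bar> * (1 + f x) \<le> 1 \<Longrightarrow>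
       \<exists>U\<in>\<U>. h (s, x) \<in> U \<and> h (t, x) \<in> U"
proof -
  define R where "R x u \<longleftrightarrow> 0 \<le> u \<and> (\<forall>s\<in>{0..1}. \<forall>t\<in>{0..1}. \<bar>s - t\<bar> * (1 + u) \<le> 1 \<longrightarrow>
     (\<exists>U\<in>\<U>. h (s, x) \<in> U \<and> h (t, x) \<in> U))" for x :: 'a and u :: real
  have mono: "R x v" if "R x u" "u \<le> v" for x u v
    unfolding R_def
  proof (intro conjI ballI impI)
    show "0 \<le> v" using that by (simp add: R_def)
    fix s t :: real assume st: "s \<in> {0..1}" "t \<in> {0..1}" "\<bar>s - t\<bar> * (1 + v) \<le> 1"
    have "\<bar>s - t\<bar> * (1 + u) \<le> \<bar>s - t\<bar> * (1 + v)"
      using that(2) by (intro mult_left_mono) auto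
    then have "\<bar>s - t\<bar> * (1 + u) \<le> 1" using st(3) by linarith
    then show "\<exists>U\<in>\<U>. h (s, x) \<in> U \<and> h (t, x) \<in> U" using that(1) st unfolding R_def by blast
  qed
  have loc: "\<exists>V n. openin X V \<and> x \<in> V \<and> (\<forall>y\<in>V. R y (real n))" if x: "x \<in> topspace X" for x
  proof -
    define \<G> where "\<G> = {G. open G \<and> (\<exists>B. openin X B \<and> x \<in> B \<and>
      (\<exists>U\<in>\<U>. \<forall>t\<in>G \<inter> {0..1}. \<forall>y\<in>B. h (t, y) \<in> U))}"
    have cover: "s \<in> \<Union>\<G>" if s: "s \<in> {0..1}" for s :: real
    proof -
      have sx: "(s, x) \<in> topspace (prod_topology (top_of_set {0..1::real}) X)" using s x by simp
      then have "h (s, x) \<in> \<Union>\<U>"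
        using continuous_map_image_subset_topspace[OF h] \<U> by (auto simp: open_cover_def)
      then obtain U where U: "U \<in> \<U>" "h (s, x) \<in> U" by (rule UnionE)
      define W where "W = {z \<in> topspace (prod_topology (top_of_set {0..1::real}) X). h z \<in> U}"
      have W: "openin (prod_topology (top_of_set {0..1::real}) X) W"
        unfolding W_def using U(1) \<U> by (intro openin_continuous_map_preimage[OF h]) (auto simp: open_cover_def)
      have "(s, x) \<in> W" using sx U by (simp add: W_def)
      then obtain A B where AB: "openin (top_of_set {0..1::real}) A" "openin X B" "s \<in> A" "x \<in> B" "A \<times> B \<subseteq> W"
        using openin_prod_topology_alt[THEN iffD1, OF W, rule_format, OF \<open>(s, x) \<in> W\<close>]
        by (elim exE conjE) (rule that)
      obtain G where G: "open G" "A = {0..1} \<inter> G" using AB(1) by (auto simp: openin_open)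
      have "\<forall>t\<in>G \<inter> {0..1}. \<forall>y\<in>B. h (t, y) \<in> U"
        using AB(5) G(2) by (auto simp: W_def)
      then have "G \<in> \<G>" using G AB U unfolding \<G>_def by blast
      then show ?thesis using AB(3) G by blast
    qed
    have sub: "{0..1} \<subseteq> \<Union>\<G>" by (rule subsetI) (rule cover)
    obtain \<G>' where G': "\<G>' \<subseteq> \<G>" "finite \<G>'" "{0..1} \<subseteq> \<Union>\<G>'"
      by (rule compactE[OF compact_Icc sub]) (auto simp: \<G>_def)
    have "\<And>G. G \<in> \<G>' \<Longrightarrow> open G" using G'(1) by (auto simp: \<G>_def)
    then obtain e where e: "0 < e" "\<And>s. s \<in> {0..1} \<Longrightarrow> \<exists>G\<in>\<G>'. ball s e \<subseteq> G"
      using Heine_Borel_lemma[OF compact_Icc G'(3)] by blast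
    have "\<forall>G\<in>\<G>'. \<exists>B. openin X B \<and> x \<in> B \<and> (\<exists>U\<in>\<U>. \<forall>t\<in>G \<inter> {0..1}. \<forall>y\<in>B. h (t, y) \<in> U)"
      using G'(1) unfolding \<G>_def by blast
    then obtain B where B: "\<forall>G\<in>\<G>'. openin X (B G) \<and> x \<in> B G \<and> (\<exists>U\<in>\<U>. \<forall>t\<in>G \<inter> {0..1}. \<forall>y\<in>B G. h (t, y) \<in> U)"
      by metis
    define V where "V = (\<Inter>G\<in>\<G>'. B G) \<inter> topspace X"
    have "openin X V" unfolding V_def using G'(2) B by (intro openin_INT) auto
    moreover have "x \<in> V" using B x by (auto simp: V_def)
    moreover obtain n where n: "inverse (real (Suc n)) < e" using reals_Archimedean[OF e(1)] by blast
    have "R y (real n)" if y: "y \<in> V" for y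
      unfolding R_def
    proof (intro conjI ballI impI)
      fix s t :: real assume st: "s \<in> {0..1}" "t \<in> {0..1}" "\<bar>s - t\<bar> * (1 + real n) \<le> 1"
      have "\<bar>s - t\<bar> \<le> inverse (real (Suc n))" using st(3) by (simp add: field_simps)
      then have "dist s t < e" using n by (simp add: dist_real_def)
      obtain G where G: "G \<in> \<G>'" "ball s e \<subseteq> G" using e(2)[OF st(1)] by blast
      then have stG: "s \<in> G \<inter> {0..1}" "t \<in> G \<inter> {0..1}"
        using \<open>dist s t < e\<close> e(1) st(1,2) by auto
      have yB: "y \<in> B G" using y G by (auto simp: V_def)
      have "\<exists>U\<in>\<U>. \<forall>t\<in>G \<inter> {0..1}. \<forall>y\<in>B G. h (t, y) \<in> U" using bspec[OF B G(1)] by simp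
      then obtain U where "U \<in> \<U>" "\<forall>t\<in>G \<inter> {0..1}. \<forall>y\<in>B G. h (t, y) \<in> U" by (rule bexE)
      with stG yB show "\<exists>U\<in>\<U>. h (s, y) \<in> U \<and> h (t, y) \<in> U" by blast
    qed simp
    ultimately show ?thesis by blast
  qed
  obtain f where f: "continuous_map X euclideanreal f" "\<And>x. x \<in> topspace X \<Longrightarrow> 0 \<le> f x"
    "\<And>x. x \<in> topspace X \<Longrightarrow> R x (f x)"
    using mono loc by (rule continuous_majorant[OF assms(1,2)]) blast+
  show thesis
    by (rule that[OF f(1,2)]) (use f(3) in \<open>auto simp: R_def\<close>)
qed

text \<open>
  The homotopy is traversed in steps whose length is the Lebesgue number at the point, stopping at
  time \<open>1\<close>. Near \<open>x\<close> all the points have stopped after a common number of steps, so only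
  finitely many smallness conditions have to be met there.
\<close>
lemma homotopy_cobounds:
  assumes X: "paracompact_space X" "Hausdorff_space X"
    and h: "continuous_map (prod_topology (top_of_set {0..1::real}) X) Y h"
    and c: "cocycle q Y c"
  shows "cobounds q X (\<lambda>xs. c (map (\<lambda>x. h (1, x)) xs) - c (map (\<lambda>x. h (0, x)) xs))"
proof -
  obtain \<U> where \<U>: "open_cover Y \<U>"
    and c0: "\<forall>U\<in>\<U>. \<forall>ys. set ys \<subseteq> U \<longrightarrow> length ys = Suc (Suc q) \<longrightarrow> codiff c ys = 0"
    using c unfolding cocycle_def for_small_def by blast
  obtain f where f: "continuous_map X euclideanreal f" "\<And>x. x \<in> topspace X \<Longrightarrow> 0 \<le> f x"
    and mesh: "\<And>x s t. x \<in> topspace X \<Longrightarrow> s \<in> {0..1} \<Longrightarrow> t \<in> {0..1} \<Longrightarrow> \<bar>s - t\<bar> * (1 + f x) \<le> 1 \<Longrightarrow>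
       \<exists>U\<in>\<U>. h (s, x) \<in> U \<and> h (t, x) \<in> U"
    using homotopy_mesh[OF X h \<U>] by metis
  define \<sigma> where "\<sigma> k x = min 1 (real k / (1 + f x))" for k x
  define g where "g k x = h (\<sigma> k x, x)" for k x
  have pos: "0 < 1 + f x" if "x \<in> topspace X" for x using f(2)[OF that] by simp
  have \<sigma>: "\<sigma> k x \<in> {0..1}" if "x \<in> topspace X" for k x
    using pos[OF that] by (auto simp: \<sigma>_def)
  have \<sigma>1: "\<sigma> k x = 1" if "x \<in> topspace X" "1 + f x \<le> real k" for k x
    using pos[OF that(1)] that(2) by (simp add: \<sigma>_def min_def field_simps)
  have \<sigma>_step: "\<bar>\<sigma> k x - \<sigma> (Suc k) x\<bar> * (1 + f x) \<le> 1" if "x \<in> topspace X" for k x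
  proof -
    have "real (Suc k) / (1 + f x) - real k / (1 + f x) = 1 / (1 + f x)"
      by (simp add: diff_divide_distrib[symmetric])
    moreover have "0 \<le> 1 / (1 + f x)" using pos[OF that] by simp
    ultimately have "\<bar>\<sigma> k x - \<sigma> (Suc k) x\<bar> \<le> 1 / (1 + f x)" unfolding \<sigma>_def by linarith
    then show ?thesis using pos[OF that] by (simp add: field_simps)
  qed
  have \<sigma>_cont: "continuous_map X (top_of_set {0..1}) (\<sigma> k)" for k
    unfolding continuous_map_in_subtopology
  proof
    show "continuous_map X euclideanreal (\<sigma> k)"
      unfolding \<sigma>_def by (intro continuous_intros f(1)) (use pos in force)
  qed (use \<sigma> in auto)
  have g_cont: "continuous_map X Y (g k)" for k
  proof -
    have "continuous_map X (prod_topology (top_of_set {0..1}) X) (\<lambda>x. (\<sigma> k x, x))"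
      by (intro continuous_map_pairedI \<sigma>_cont) simp
    from continuous_map_compose[OF this h] show ?thesis
      by (simp add: g_def[abs_def] comp_def)
  qed
  have "cobounds q X (\<lambda>xs. c (map (\<lambda>x. h (1, x)) xs) - c (map (g 0) xs))"
  proof (rule telescoping_homotopy)
    show "\<exists>n. \<forall>k\<ge>n. g k x = h (1, x)" if "x \<in> topspace X" for x
    proof -
      obtain n where "1 + f x \<le> real n" using real_arch_simple by blast
      then show ?thesis using \<sigma>1[OF that] by (intro exI[of _ n]) (auto simp: g_def)
    qed
    show "codiff c ys = 0" if "U \<in> \<U>" "set ys \<subseteq> U" "length ys = Suc (Suc q)" for U ys
      using c0 that by blast
    show "for_small X (\<lambda>xs. \<forall>k. \<exists>U\<in>\<U>. g k ` set xs \<union> g (Suc k) ` set xs \<subseteq> U)"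
    proof (rule for_smallI_pointwise)
      fix x assume x: "x \<in> topspace X"
      \<comment> \<open>Near \<open>x\<close> the majorant stays below \<open>f x + 1\<close>, hence \<open>n\<close> steps suffice for all the points there.\<close>
      obtain n where n: "2 + f x \<le> real n" using real_arch_simple by blast
      have "\<exists>U\<in>\<U>. g k x \<in> U \<and> g (Suc k) x \<in> U" for k
        using mesh[OF x \<sigma>[OF x] \<sigma>[OF x] \<sigma>_step[OF x]] by (auto simp: g_def)
      then obtain U where U: "\<And>k. U k \<in> \<U> \<and> g k x \<in> U k \<and> g (Suc k) x \<in> U k" by metis
      have U_open: "openin Y (U k)" for k using U \<U> by (auto simp: open_cover_def)
      define W0 where "W0 = {y \<in> topspace X. f y \<in> {..<f x + 1}}"
      define W where "W k = {y \<in> topspace X. g k y \<in> U k} \<inter> {y \<in> topspace X. g (Suc k) y \<in> U k}" for k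
      have "openin X W0" unfolding W0_def by (rule openin_continuous_map_preimage[OF f(1)]) simp
      moreover have "openin X (W k)" for k
        unfolding W_def by (intro openin_Int openin_continuous_map_preimage[OF g_cont U_open])
      ultimately have W_open: "openin X (W0 \<inter> ((\<Inter>k\<in>{..n}. W k) \<inter> topspace X))"
        by (intro openin_Int openin_INT) auto
      have xW: "x \<in> W0 \<inter> ((\<Inter>k\<in>{..n}. W k) \<inter> topspace X)"
        using x U by (auto simp: W0_def W_def)
      have "\<exists>V\<in>\<U>. g k ` set xs \<union> g (Suc k) ` set xs \<subseteq> V"
        if xs: "set xs \<subseteq> W0 \<inter> ((\<Inter>k\<in>{..n}. W k) \<inter> topspace X)" for xs k
      proof -
        have stat: "g j y = g n y" if "y \<in> set xs" "n \<le> j" for j y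
        proof -
          have "y \<in> topspace X" "f y < f x + 1" using xs that by (auto simp: W0_def)
          then have "\<sigma> j y = 1" "\<sigma> n y = 1" using that n by (auto intro!: \<sigma>1)
          then show ?thesis by (simp add: g_def)
        qed
        have sub: "g j y \<in> U j \<and> g (Suc j) y \<in> U j" if "y \<in> set xs" "j \<le> n" for j y
          using xs that by (auto simp: W_def)
        have "g k y \<in> U (min k n) \<and> g (Suc k) y \<in> U (min k n)" if "y \<in> set xs" for y
        proof (cases "k \<le> n")
          case True
          then show ?thesis using sub[OF that] by simp
        next
          case False
          then show ?thesis using sub[OF that, of n] stat[OF that, of k] stat[OF that, of "Suc k"] by simp
        qed
        then show ?thesis using U by (intro bexI[of _ "U (min k n)"]) auto
      qed
      then show "\<exists>W. openin X W \<and> x \<in> W \<and>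
          (\<forall>xs. set xs \<subseteq> W \<longrightarrow> (\<forall>k. \<exists>V\<in>\<U>. g k ` set xs \<union> g (Suc k) ` set xs \<subseteq> V))" 
        by (intro exI[of _ "W0 \<inter> ((\<Inter>k\<in>{..n}. W k) \<inter> topspace X)"] conjI W_open xW) simp
    qed
  qed
  moreover have "g 0 = (\<lambda>x. h (0, x))" by (simp add: g_def[abs_def] \<sigma>_def)
  ultimately show ?thesis by simp
qed

section \<open>Tautness of compact sets\<close>

text \<open>
  Cover \<open>K\<close> by finitely many open sets \<open>B\<close> whose closures lie in members of \<open>\<W>\<close>. It suffices that
  \<open>f y\<close> lies in the closure of every \<open>B\<close> that contains \<open>y\<close>. Such a point exists in \<open>K\<close> unless
  the closures of those \<open>B\<close> have an intersection that misses \<open>K\<close>; there are only finitely many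
  intersections of that kind, they are closed, and \<open>N\<close> avoids them.
\<close>
lemma near_retraction:
  assumes Y: "regular_space Y" and K: "compactin Y K"
    and \<W>: "\<And>W. W \<in> \<W> \<Longrightarrow> openin Y W" "K \<subseteq> \<Union>\<W>"
  obtains N f where "openin Y N" "K \<subseteq> N" "\<And>x. x \<in> N \<Longrightarrow> f x \<in> K" "\<And>x. x \<in> K \<Longrightarrow> f x = x"
    "\<And>x. x \<in> N \<Longrightarrow> \<exists>V. openin Y V \<and> x \<in> V \<and> (\<exists>W\<in>\<W>. \<forall>y\<in>V \<inter> N. y \<in> W \<and> f y \<in> W)"
proof -
  define \<O> where "\<O> = {B. openin Y B \<and> (\<exists>W\<in>\<W>. Y closure_of B \<subseteq> W)}"
  have "K \<subseteq> \<Union>\<O>"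
  proof
    fix x assume "x \<in> K"
    then obtain W where W: "W \<in> \<W>" "x \<in> W" using \<W>(2) by blast
    then have "closedin Y (topspace Y - W)" "x \<in> topspace Y - (topspace Y - W)"
      using \<W>(1) openin_subset by auto
    then obtain B where B: "openin Y B" "x \<in> B" "disjnt (topspace Y - W) (Y closure_of B)"
      using Y unfolding regular_space by blast
    then have "Y closure_of B \<subseteq> W" using closure_of_subset_topspace[of Y B] by (auto simp: disjnt_iff)
    then show "x \<in> \<Union>\<O>" using B W unfolding \<O>_def by blast
  qed
  then obtain \<F> where \<F>: "finite \<F>" "\<F> \<subseteq> \<O>" "K \<subseteq> \<Union>\<F>"
    using K unfolding compactin_def \<O>_def by (metis (no_types, lifting) mem_Collect_eq)
  have cl: "B \<subseteq> Y closure_of B" if "B \<in> \<F>" for B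
    using that \<F>(2) by (intro closure_of_subset openin_subset) (auto simp: \<O>_def)
  define H where "H S = (\<Inter>B\<in>S. Y closure_of B)" for S
  \<comment> \<open>The empty family is left out: its intersection is the whole type, which need not be a closed set.\<close>
  define bad where "bad = {S \<in> Pow \<F>. S \<noteq> {} \<and> K \<inter> H S = {}}"
  define N where "N = \<Union>\<F> - (\<Union>S\<in>bad. H S)"
  have "closedin Y (H S)" if "S \<in> bad" for S
    unfolding H_def using that by (intro closedin_INT) (auto simp: bad_def)
  moreover have "finite bad" using \<F>(1) by (simp add: bad_def)
  ultimately have "closedin Y (\<Union>S\<in>bad. H S)" by (intro closedin_Union) auto
  moreover have "openin Y (\<Union>\<F>)" using \<F>(2) by (intro openin_Union) (auto simp: \<O>_def)
  ultimately have N_open: "openin Y N" unfolding N_def by (rule openin_diff[rotated])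
  have KN: "K \<subseteq> N" using \<F>(3) by (auto simp: N_def bad_def)
  have "\<exists>k\<in>K. \<forall>B\<in>\<F>. y \<in> B \<longrightarrow> k \<in> Y closure_of B" if y: "y \<in> N" for y
  proof -
    define S where "S = {B \<in> \<F>. y \<in> B}"
    have "y \<in> H S" using cl by (auto simp: S_def H_def)
    then have "S \<notin> bad" using y by (auto simp: N_def)
    moreover have "S \<noteq> {}" "S \<subseteq> \<F>" using y by (auto simp: S_def N_def)
    ultimately have "K \<inter> H S \<noteq> {}" by (auto simp: bad_def)
    then show ?thesis by (auto simp: S_def H_def)
  qed
  then obtain k where k: "\<And>y. y \<in> N \<Longrightarrow> k y \<in> K" "\<And>y B. y \<in> N \<Longrightarrow> B \<in> \<F> \<Longrightarrow> y \<in> B \<Longrightarrow> k y \<in> Y closure_of B"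
    by metis
  define f where "f y = (if y \<in> K then y else k y)" for y
  show thesis
  proof (rule that[OF N_open KN])
    show "f x \<in> K" if "x \<in> N" for x using k(1)[OF that] by (simp add: f_def)
    show "f x = x" if "x \<in> K" for x using that by (simp add: f_def)
    fix x assume "x \<in> N"
    then obtain B where B: "B \<in> \<F>" "x \<in> B" by (auto simp: N_def)
    then obtain W where W: "openin Y B" "W \<in> \<W>" "Y closure_of B \<subseteq> W" using \<F>(2) by (auto simp: \<O>_def)
    have "y \<in> W \<and> f y \<in> W" if "y \<in> B \<inter> N" for y
      using that cl[OF B(1)] W(3) k(2)[of y B] B(1) by (auto simp: f_def)
    then show "\<exists>V. openin Y V \<and> x \<in> V \<and> (\<exists>W\<in>\<W>. \<forall>y\<in>V \<inter> N. y \<in> W \<and> f y \<in> W)"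
      using B(2) W by blast
  qed
qed

section \<open>Semiflows and entrance times\<close>

lemma semiflow_continuous:
  "semiflow X \<phi> \<Longrightarrow> continuous_map (prod_topology X (top_of_set {0..})) X (\<lambda>(p, t). \<phi> p t)"
  by (simp add: dynamical_system_def)

lemma semiflow_in_topspace:
  assumes "semiflow X \<phi>" "p \<in> topspace X" "0 \<le> t"
  shows "\<phi> p t \<in> topspace X"
  using continuous_map_image_subset_topspace[OF semiflow_continuous[OF assms(1)]] assms(2,3)
  by (force simp: image_subset_iff)

lemma semiflow_add:
  assumes "semiflow X \<phi>" "p \<in> topspace X" "0 \<le> s" "0 \<le> t"
  shows "\<phi> (\<phi> p s) t = \<phi> p (s + t)"
  using assms by (simp add: dynamical_system_def)

lemma semiflow_subtopology:
  assumes X: "semiflow X \<phi>" and S: "positively_invariant \<phi> S"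
  shows "semiflow (subtopology X S) \<phi>"
proof -
  have eq: "prod_topology (subtopology X S) (top_of_set {0..}) = subtopology (prod_topology X (top_of_set {0..})) (S \<times> {0..})"
    by (simp only: prod_topology_subtopology(1) topspace_euclidean_subtopology)
  have "continuous_map (prod_topology (subtopology X S) (top_of_set {0..})) X (\<lambda>(p, t). \<phi> p t)"
    unfolding eq by (rule continuous_map_from_subtopology[OF semiflow_continuous[OF X]])
  then have "continuous_map (prod_topology (subtopology X S) (top_of_set {0..})) (subtopology X S) (\<lambda>(p, t). \<phi> p t)"
    using S by (auto simp: continuous_map_in_subtopology positively_invariant_def)
  then show ?thesis using X by (simp add: dynamical_system_def)
qed

lemma semiflow_homotopy:
  assumes X: "semiflow X \<phi>" and \<tau>: "continuous_map X euclideanreal \<tau>" "\<And>p. p \<in> topspace X \<Longrightarrow> 0 \<le> \<tau> p"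
  shows "continuous_map (prod_topology (top_of_set {0..1}) X) X (\<lambda>(s, p). \<phi> p (s * \<tau> p))"
proof -
  let ?I = "prod_topology (top_of_set {0..1::real}) X"
  have "continuous_map ?I (top_of_set {0..1}) fst" by (rule continuous_map_fst)
  then have "continuous_map ?I euclideanreal (\<lambda>z. fst z)" by (simp add: continuous_map_in_subtopology)
  moreover have "continuous_map ?I euclideanreal (\<lambda>z. \<tau> (snd z))"
    using continuous_map_compose[OF continuous_map_snd \<tau>(1)] by (simp add: comp_def)
  ultimately have "continuous_map ?I euclideanreal (\<lambda>z. fst z * \<tau> (snd z))"
    by (rule continuous_map_real_mult)
  then have "continuous_map ?I (top_of_set {0..}) (\<lambda>z. fst z * \<tau> (snd z))"
    using \<tau>(2) by (auto simp: continuous_map_in_subtopology)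
  then have "continuous_map ?I (prod_topology X (top_of_set {0..})) (\<lambda>z. (snd z, fst z * \<tau> (snd z)))"
    by (intro continuous_map_pairedI) (simp_all add: continuous_map_snd)
  from continuous_map_compose[OF this semiflow_continuous[OF X]] show ?thesis
    by (simp add: comp_def case_prod_unfold)
qed

text \<open>
  By continuity, a time at which \<open>p\<close> is in the interior of \<open>P\<close> works for all points near \<open>p\<close>,
  and so do all the later times since \<open>P\<close> is positively invariant.
\<close>
lemma continuous_entrance_time:
  assumes X: "semiflow X \<phi>" "paracompact_space X" "Hausdorff_space X"
    and P: "positively_invariant \<phi> P"
    and enters: "\<And>p. p \<in> topspace X \<Longrightarrow> \<exists>t\<ge>0. \<phi> p t \<in> X interior_of P"
  shows "\<exists>\<tau>. continuous_map X euclideanreal \<tau> \<and> (\<forall>p\<in>topspace X. 0 \<le> \<tau> p \<and> \<phi> p (\<tau> p) \<in> P)"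
proof -
  define R where "R p t \<longleftrightarrow> p \<in> topspace X \<and> 0 \<le> t \<and> \<phi> p t \<in> P" for p t
  have mono: "R p t" if "R p s" "s \<le> t" for p s t
  proof -
    have "\<phi> p t = \<phi> (\<phi> p s) (t - s)" using that semiflow_add[OF X(1), of p s "t - s"] by (simp add: R_def)
    then show ?thesis using that P by (simp add: R_def positively_invariant_def)
  qed
  have loc: "\<exists>U n. openin X U \<and> p \<in> U \<and> (\<forall>q\<in>U. R q (real n))" if p: "p \<in> topspace X" for p
  proof -
    obtain t where t: "0 \<le> t" "\<phi> p t \<in> X interior_of P" using enters[OF p] by blast
    obtain n where n: "t \<le> real n" using real_arch_simple by blast
    define U where "U = {q \<in> topspace X. \<phi> q t \<in> X interior_of P}"
    have "continuous_map X (prod_topology X (top_of_set {0..})) (\<lambda>q. (q, t))"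
      by (intro continuous_map_pairedI) (use t(1) in simp_all)
    from continuous_map_compose[OF this semiflow_continuous[OF X(1)]]
    have "continuous_map X X (\<lambda>q. \<phi> q t)" by (simp add: comp_def)
    then have "openin X U" unfolding U_def by (rule openin_continuous_map_preimage) simp
    moreover have "R q (real n)" if "q \<in> U" for q
    proof (rule mono[OF _ n])
      show "R q t" using that t(1) interior_of_subset[of X P] by (auto simp: R_def U_def)
    qed
    ultimately show ?thesis using p t(2) by (intro exI[of _ U] exI[of _ n]) (auto simp: U_def)
  qed
  obtain \<tau> where \<tau>: "continuous_map X euclideanreal \<tau>" "\<And>p. p \<in> topspace X \<Longrightarrow> 0 \<le> \<tau> p"
    "\<And>p. p \<in> topspace X \<Longrightarrow> R p (\<tau> p)"
    using mono loc by (rule continuous_majorant[OF X(2,3)]) blast+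
  then show ?thesis by (intro exI[of _ \<tau>]) (auto simp: R_def)
qed

text \<open>
  The basin contains a neighbourhood of \<open>K\<close>; hence sets that
  are open in the basin contain neighbourhoods of \<open>K\<close> in the whole space, and stability applies to
  these.
\<close>
lemma basin_entrance:
  assumes sys: "T = UNIV \<and> flow X \<phi> \<or> T = {0..} \<and> semiflow X \<phi>"
    and attr: "attractor T X \<phi> K"
    and Z: "Z = basin X \<phi> K"
    and sep: "Hausdorff_space (subtopology X Z)" "paracompact_space (subtopology X Z)"
  shows "semiflow (subtopology X Z) \<phi>" "K \<subseteq> Z" "compactin X K" "positively_invariant \<phi> K"
    and "openin (subtopology X Z) N \<Longrightarrow> K \<subseteq> N \<Longrightarrow>
      \<exists>\<tau>. continuous_map (subtopology X Z) euclideanreal \<tau> \<and>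
        (\<forall>p\<in>topspace (subtopology X Z). 0 \<le> \<tau> p \<and> \<phi> p (\<tau> p) \<in> N)"
proof -
  have T: "{0..} \<subseteq> T" using sys by auto
  have flow: "semiflow X \<phi>"
  proof -
    have sys': "dynamical_system T X \<phi>" using sys by auto
    have "top_of_set {0..} = subtopology (top_of_set T) {0..}"
      using T by (simp add: subtopology_subtopology inf_absorb2)
    then have eq: "prod_topology X (top_of_set {0..}) = subtopology (prod_topology X (top_of_set T)) (topspace X \<times> {0..})"
      by (simp only: prod_topology_subtopology(2))
    have "continuous_map (prod_topology X (top_of_set T)) X (\<lambda>(p, t). \<phi> p t)"
      using sys' by (simp add: dynamical_system_def)
    then have "continuous_map (prod_topology X (top_of_set {0..})) X (\<lambda>(p, t). \<phi> p t)"
      unfolding eq by (rule continuous_map_from_subtopology)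
    then show ?thesis using sys' T unfolding dynamical_system_def by blast
  qed
  show K: "compactin X K" using attr by (simp add: attractor_def)
  then have KX: "K \<subseteq> topspace X" by (rule compactin_subset_topspace)
  have stab: "asymptotically_stable X \<phi> K" using attr by (simp add: attractor_def)
  show Kinv: "positively_invariant \<phi> K"
    using attr T by (fastforce simp: attractor_def invariant_set_def positively_invariant_def)
  show KZ: "K \<subseteq> Z"
  proof
    fix p assume p: "p \<in> K"
    have "attracted_to X \<phi> K p"
      unfolding attracted_to_def
    proof (intro allI impI)
      fix U assume "nbhd_of X K U"
      then have "K \<subseteq> U" using interior_of_subset[of X U] by (auto simp: nbhd_of_def)
      then show "\<forall>\<^sub>F t in at_top. \<phi> p t \<in> U"
        using Kinv p by (intro eventually_at_top_linorderI[of 0]) (auto simp: positively_invariant_def)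
    qed
    then show "p \<in> Z" using p KX by (auto simp: Z basin_def)
  qed
  have ZX: "Z \<subseteq> topspace X" by (auto simp: Z basin_def)
  then have top: "topspace (subtopology X Z) = Z" by auto
  have Zinv: "positively_invariant \<phi> Z"
    unfolding positively_invariant_def
  proof (intro ballI allI impI)
    fix p and t :: real assume p: "p \<in> Z" and t: "0 \<le> t"
    have pX: "p \<in> topspace X" using p ZX by blast
    have "attracted_to X \<phi> K (\<phi> p t)"
      unfolding attracted_to_def
    proof (intro allI impI)
      fix U assume "nbhd_of X K U"
      then have "\<forall>\<^sub>F s in at_top. \<phi> p s \<in> U" using p by (auto simp: Z basin_def attracted_to_def)
      then obtain s0 where s0: "\<And>s. s0 \<le> s \<Longrightarrow> \<phi> p s \<in> U" by (auto simp: eventually_at_top_linorder)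
      show "\<forall>\<^sub>F s in at_top. \<phi> (\<phi> p t) s \<in> U"
      proof (rule eventually_at_top_linorderI[of "max 0 s0"])
        fix s assume "max 0 s0 \<le> s"
        then show "\<phi> (\<phi> p t) s \<in> U" using semiflow_add[OF flow pX t, of s] s0[of "t + s"] t by simp
      qed
    qed
    then show "\<phi> p t \<in> Z" using semiflow_in_topspace[OF flow pX t] by (simp add: Z basin_def)
  qed
  show Zflow: "semiflow (subtopology X Z) \<phi>" by (rule semiflow_subtopology[OF flow Zinv])
  assume N: "openin (subtopology X Z) N" "K \<subseteq> N"
  obtain N' where N': "openin X N'" "N = N' \<inter> Z" using N(1) by (auto simp: openin_subtopology)
  obtain M where M: "nbhd_of X K M" "\<forall>p\<in>M. attracted_to X \<phi> K p"
    using stab by (auto simp: asymptotically_stable_def)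
  have MZ: "M \<subseteq> Z" using M by (auto simp: nbhd_of_def Z basin_def)
  have "nbhd_of X K (N' \<inter> M)"
    using M(1) N' N(2) openin_subset[OF N'(1)] interior_of_openin[OF N'(1)]
    by (auto simp: nbhd_of_def interior_of_Int)
  then obtain P where P: "P \<subseteq> N' \<inter> M" "nbhd_of X K P" "positively_invariant \<phi> P"
    using stab by (auto simp: asymptotically_stable_def)
  have PN: "P \<subseteq> N" using P(1) MZ N'(2) by blast
  have "\<exists>t\<ge>0. \<phi> p t \<in> subtopology X Z interior_of P" if p: "p \<in> topspace (subtopology X Z)" for p
  proof -
    have "nbhd_of X K (X interior_of P)"
      using P(2) interior_of_subset_topspace[of X P] by (simp add: nbhd_of_def)
    then have "\<forall>\<^sub>F t in at_top. \<phi> p t \<in> X interior_of P"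
      using p top by (auto simp: Z basin_def attracted_to_def)
    then obtain t0 where t0: "\<And>t. t0 \<le> t \<Longrightarrow> \<phi> p t \<in> X interior_of P"
      by (auto simp: eventually_at_top_linorder)
    have "X interior_of P \<subseteq> subtopology X Z interior_of P"
    proof (rule interior_of_maximal[OF interior_of_subset])
      have "X interior_of P = X interior_of P \<inter> Z"
        using interior_of_subset[of X P] P(1) MZ by blast
      then show "openin (subtopology X Z) (X interior_of P)"
        by (metis openin_interior_of openin_subtopology_Int)
    qed
    then show ?thesis using t0[of "max 0 t0"] by (intro exI[of _ "max 0 t0"]) auto
  qed
  then have "\<exists>\<tau>. continuous_map (subtopology X Z) euclideanreal \<tau> \<and>
      (\<forall>p\<in>topspace (subtopology X Z). 0 \<le> \<tau> p \<and> \<phi> p (\<tau> p) \<in> P)"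
    by (rule continuous_entrance_time[OF Zflow sep(2,1) P(3)])
  then show "\<exists>\<tau>. continuous_map (subtopology X Z) euclideanreal \<tau> \<and>
        (\<forall>p\<in>topspace (subtopology X Z). 0 \<le> \<tau> p \<and> \<phi> p (\<tau> p) \<in> N)"
    using PN by blast
qed

section \<open>Restriction to the attractor\<close>

text \<open>
  The basin \<open>Y\<close> and the attractor \<open>K\<close>, with asymptotic stability condensed into the existence of
  continuous times at which all points are in a prescribed neighbourhood of \<open>K\<close>.
\<close>
locale deformable_pair =
  fixes Y :: "'a topology" and \<phi> :: "'a \<Rightarrow> real \<Rightarrow> 'a" and K :: "'a set"
  assumes flow: "semiflow Y \<phi>" and para: "paracompact_space Y" and haus: "Hausdorff_space Y"
    and compact: "compactin Y K" and inv: "positively_invariant \<phi> K"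
    and entrance: "\<And>N. openin Y N \<Longrightarrow> K \<subseteq> N \<Longrightarrow> \<exists>\<tau>. continuous_map Y euclideanreal \<tau> \<and>
        (\<forall>p\<in>topspace Y. 0 \<le> \<tau> p \<and> \<phi> p (\<tau> p) \<in> N)"
begin

lemma K_sub: "K \<subseteq> topspace Y" using compact by (rule compactin_subset_topspace)

text \<open>
  The map \<open>r\<close> follows the semiflow into a small neighbourhood of \<open>K\<close>, and \<open>g\<close> moves on from there
  to a nearby point of \<open>K\<close>. The last two conclusions express that \<open>r\<close> is homotopic to the identity
  both on \<open>Y\<close> and on \<open>K\<close>.
\<close>
lemma push_into_K:
  fixes \<W> :: "'a set set"
  assumes \<W>: "\<And>W. W \<in> \<W> \<Longrightarrow> openin Y W" "K \<subseteq> \<Union>\<W>"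
  obtains r g where "\<And>x. x \<in> topspace Y \<Longrightarrow> g x \<in> K" "\<And>x. x \<in> K \<Longrightarrow> g x = r x"
    "for_small Y (\<lambda>xs. \<exists>W\<in>\<W>. r ` set xs \<union> g ` set xs \<subseteq> W)"
    "\<And>q (c :: 'a list \<Rightarrow> 'k::field). cocycle q Y c \<Longrightarrow> cobounds q Y (\<lambda>xs. c xs - c (map r xs))"
    "\<And>q (c :: 'a list \<Rightarrow> 'k::field). cocycle q (subtopology Y K) c \<Longrightarrow>
       cobounds q (subtopology Y K) (\<lambda>xs. c xs - c (map r xs))"
proof -
  obtain N f where N: "openin Y N" "K \<subseteq> N" "\<And>x. x \<in> N \<Longrightarrow> f x \<in> K" "\<And>x. x \<in> K \<Longrightarrow> f x = x"
    and NV: "\<And>x. x \<in> N \<Longrightarrow> \<exists>V. openin Y V \<and> x \<in> V \<and> (\<exists>W\<in>\<W>. \<forall>y\<in>V \<inter> N. y \<in> W \<and> f y \<in> W)"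
    by (rule near_retraction[OF paracompact_Hausdorff_imp_regular_space[OF para haus] compact \<W>]) blast+
  obtain \<tau> where \<tau>: "continuous_map Y euclideanreal \<tau>" "\<And>p. p \<in> topspace Y \<Longrightarrow> 0 \<le> \<tau> p"
     "\<And>p. p \<in> topspace Y \<Longrightarrow> \<phi> p (\<tau> p) \<in> N"
    using entrance[OF N(1,2)] by blast
  define r where "r p = \<phi> p (\<tau> p)" for p
  have homotopic: "cobounds q X (\<lambda>xs. c xs - c (map r xs))"
    if X: "semiflow X \<phi>" "paracompact_space X" "Hausdorff_space X" "continuous_map X euclideanreal \<tau>"
      "topspace X \<subseteq> topspace Y" and c: "cocycle q X c" for q and X and c :: "'a list \<Rightarrow> 'k"
  proof -
    have "continuous_map (prod_topology (top_of_set {0..1}) X) X (\<lambda>(s, p). \<phi> p (s * \<tau> p))"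
      using semiflow_homotopy[OF X(1,4)] \<tau>(2) X(5) by blast
    from cobounds_minus[OF homotopy_cobounds[OF X(2,3) this c]]
    have *: "cobounds q X (\<lambda>xs. c (map (\<lambda>x. \<phi> x 0) xs) - c (map r xs))"
      by (simp add: r_def[abs_def])
    have "map (\<lambda>x. \<phi> x 0) xs = xs" if "set xs \<subseteq> topspace X" for xs
      using that X(1) by (intro map_idI) (auto simp: dynamical_system_def)
    then show ?thesis by (intro cobounds_cong[OF *]) simp
  qed
  have r_cont: "continuous_map Y Y r"
  proof -
    have "continuous_map Y (prod_topology Y (top_of_set {0..})) (\<lambda>p. (p, \<tau> p))"
      using \<tau> by (intro continuous_map_pairedI) (auto simp: continuous_map_in_subtopology)
    from continuous_map_compose[OF this semiflow_continuous[OF flow]]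
    show ?thesis by (simp add: comp_def r_def[abs_def])
  qed
  show thesis
  proof (rule that[of "\<lambda>p. f (r p)" r])
    show "f (r x) \<in> K" if "x \<in> topspace Y" for x
      using N(3) \<tau>(3)[OF that] by (simp add: r_def)
    show "f (r x) = r x" if "x \<in> K" for x
    proof (rule N(4))
      show "r x \<in> K" using that inv \<tau>(2) K_sub by (auto simp: r_def positively_invariant_def)
    qed
    show "for_small Y (\<lambda>xs. \<exists>W\<in>\<W>. r ` set xs \<union> (\<lambda>p. f (r p)) ` set xs \<subseteq> W)"
    proof (rule for_smallI_pointwise)
      fix x assume x: "x \<in> topspace Y"
      have "r x \<in> N" using \<tau>(3)[OF x] by (simp add: r_def)
      then obtain V W where V: "openin Y V" "r x \<in> V" "W \<in> \<W>" "\<forall>y\<in>V \<inter> N. y \<in> W \<and> f y \<in> W"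
        using NV by blast
      define B where "B = {y \<in> topspace Y. r y \<in> V}"
      have "openin Y B" unfolding B_def by (rule openin_continuous_map_preimage[OF r_cont V(1)])
      moreover have "r y \<in> W \<and> f (r y) \<in> W" if "y \<in> B" for y
        using that V(4) \<tau>(3)[of y] by (auto simp: B_def r_def)
      ultimately show "\<exists>U. openin Y U \<and> x \<in> U \<and>
          (\<forall>xs. set xs \<subseteq> U \<longrightarrow> (\<exists>W\<in>\<W>. r ` set xs \<union> (\<lambda>p. f (r p)) ` set xs \<subseteq> W))"
        using x V(2,3) by (intro exI[of _ B] conjI allI impI bexI[of _ W]) (auto simp: B_def)
    qed
    show "cobounds q Y (\<lambda>xs. c xs - c (map r xs))" if "cocycle q Y c" for q and c :: "'a list \<Rightarrow> 'k"
      by (rule homotopic[OF flow para haus \<tau>(1) order_refl that])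
    show "cobounds q (subtopology Y K) (\<lambda>xs. c xs - c (map r xs))" if "cocycle q (subtopology Y K) c"
      for q and c :: "'a list \<Rightarrow> 'k"
    proof (rule homotopic[OF semiflow_subtopology[OF flow inv] _ _ _ _ that])
      show "paracompact_space (subtopology Y K)"
        using compact by (intro compact_imp_paracompact_space) (simp add: compact_space_subtopology)
      show "Hausdorff_space (subtopology Y K)" using haus by (rule Hausdorff_space_subtopology)
      show "continuous_map (subtopology Y K) euclideanreal \<tau>" using \<tau>(1) by (rule continuous_map_from_subtopology)
    qed simp
  qed
qed

text \<open>
  Up to coboundaries, \<open>c\<close> equals \<open>c \<circ> r\<close> by homotopy and \<open>c \<circ> r\<close> equals \<open>c \<circ> g\<close> by closeness;
  a primitive of \<open>c\<close> on \<open>K\<close> pulls back along \<open>g\<close> to a primitive of \<open>c \<circ> g\<close>.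
\<close>
lemma restriction_injective:
  fixes c :: "'a list \<Rightarrow> 'k::field"
  assumes c: "cocycle q Y c" and K0: "cobounds q (subtopology Y K) c"
  shows "cobounds q Y c"
proof -
  obtain \<U> where U: "open_cover Y \<U>"
    "\<forall>U\<in>\<U>. \<forall>ys. set ys \<subseteq> U \<longrightarrow> length ys = Suc (Suc q) \<longrightarrow> codiff c ys = 0"
    using c unfolding cocycle_def for_small_def by blast
  obtain b \<D> where b: "b [] = 0" and D: "open_cover (subtopology Y K) \<D>"
    "\<forall>D\<in>\<D>. \<forall>xs. set xs \<subseteq> D \<longrightarrow> length xs = Suc q \<longrightarrow> c xs = codiff b xs"
    using K0 unfolding cobounds_def for_small_def by blast
  \<comment> \<open>Small enough for \<open>c\<close> to be closed there, and for \<open>b\<close> to be a primitive of \<open>c\<close> on the trace in \<open>K\<close>.\<close>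
  define \<W> where "\<W> = {W. openin Y W \<and> (\<exists>U\<in>\<U>. W \<subseteq> U) \<and> (\<exists>D\<in>\<D>. W \<inter> K \<subseteq> D)}"
  have cover: "x \<in> \<Union>\<W>" if x: "x \<in> K" for x
  proof -
    have "x \<in> \<Union>\<U>" using x K_sub U(1) by (auto simp: open_cover_def)
    then obtain U where "U \<in> \<U>" "x \<in> U" by (rule UnionE)
    have "x \<in> \<Union>\<D>" using x K_sub D(1) by (auto simp: open_cover_def)
    then obtain D where "D \<in> \<D>" "x \<in> D" by (rule UnionE)
    then obtain D' where "openin Y D'" "D = D' \<inter> K"
      using D(1) by (auto simp: open_cover_def openin_subtopology)
    moreover have "openin Y U" using U(1) \<open>U \<in> \<U>\<close> by (auto simp: open_cover_def)
    ultimately have "U \<inter> D' \<in> \<W>"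
      using \<open>U \<in> \<U>\<close> \<open>D \<in> \<D>\<close> unfolding \<W>_def
      by (intro CollectI conjI openin_Int bexI[of _ U] bexI[of _ D]) auto
    moreover have "x \<in> U \<inter> D'" using \<open>x \<in> U\<close> \<open>x \<in> D\<close> \<open>D = D' \<inter> K\<close> by blast
    ultimately show ?thesis by (rule UnionI)
  qed
  obtain r g where g: "\<And>x. x \<in> topspace Y \<Longrightarrow> g x \<in> K"
    and small: "for_small Y (\<lambda>xs. \<exists>W\<in>\<W>. r ` set xs \<union> g ` set xs \<subseteq> W)"
    and hom: "cobounds q Y (\<lambda>xs. c xs - c (map r xs))"
  proof (rule push_into_K[of \<W>])
    show "openin Y W" if "W \<in> \<W>" for W using that by (simp add: \<W>_def)
    show "K \<subseteq> \<Union>\<W>" by (rule subsetI) (rule cover)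
  qed (use c in blast)
  have "cobounds q Y (\<lambda>xs. c (map g xs) - c (map r xs))"
  proof (rule contiguous_maps)
    show "codiff c ys = 0" if "U \<in> \<U>" "set ys \<subseteq> U" "length ys = Suc (Suc q)" for U ys
      using U(2) that by blast
    show "for_small Y (\<lambda>xs. \<exists>U\<in>\<U>. r ` set xs \<union> g ` set xs \<subseteq> U)"
    proof (rule for_small_mono[OF small])
      fix xs assume "\<exists>W\<in>\<W>. r ` set xs \<union> g ` set xs \<subseteq> W"
      then obtain W where W: "W \<in> \<W>" "r ` set xs \<union> g ` set xs \<subseteq> W" by (rule bexE)
      obtain U where "U \<in> \<U>" "W \<subseteq> U" using W(1) by (auto simp: \<W>_def)
      then show "\<exists>U\<in>\<U>. r ` set xs \<union> g ` set xs \<subseteq> U"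
        using W(2) by (intro bexI[of _ U]) (rule subset_trans)
    qed
  qed
  then have contig: "cobounds q Y (\<lambda>xs. c (map r xs) - c (map g xs))" by (rule cobounds_minus)
  have "for_small Y (\<lambda>xs. length xs = Suc q \<longrightarrow> c (map g xs) = codiff (\<lambda>ys. b (map g ys)) xs)"
  proof (rule for_small_mono[OF small], rule impI)
    fix xs assume xs: "set xs \<subseteq> topspace Y" "\<exists>W\<in>\<W>. r ` set xs \<union> g ` set xs \<subseteq> W" "length xs = Suc q"
    then obtain W where W: "W \<in> \<W>" "g ` set xs \<subseteq> W" by auto
    obtain D where "D \<in> \<D>" "W \<inter> K \<subseteq> D" using W(1) by (auto simp: \<W>_def)
    moreover have "g ` set xs \<subseteq> K" using g xs(1) by auto
    ultimately have "D \<in> \<D>" "g ` set xs \<subseteq> D" using W(2) by auto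
    then have "c (map g xs) = codiff b (map g xs)" using D(2) xs(3) by simp
    then show "c (map g xs) = codiff (\<lambda>ys. b (map g ys)) xs" by (simp add: codiff_map)
  qed
  then have "cobounds q Y (\<lambda>xs. c (map g xs))"
    unfolding cobounds_def using b by (intro exI[of _ "\<lambda>ys. b (map g ys)"]) simp
  then show ?thesis using cobounds_diff_trans[OF hom] cobounds_diff_trans[OF contig] by blast
qed

text \<open>The extension is \<open>c \<circ> g\<close>. On \<open>K\<close> it agrees with \<open>c \<circ> r\<close>, and \<open>r\<close> is homotopic to the identity within \<open>K\<close>.\<close>
lemma restriction_surjective:
  fixes c :: "'a list \<Rightarrow> 'k::field"
  assumes c: "cocycle q (subtopology Y K) c"
  shows "\<exists>c'. cocycle q Y c' \<and> cobounds q (subtopology Y K) (\<lambda>xs. c xs - c' xs)"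
proof -
  obtain \<D> where D: "open_cover (subtopology Y K) \<D>"
    "\<forall>D\<in>\<D>. \<forall>xs. set xs \<subseteq> D \<longrightarrow> length xs = Suc (Suc q) \<longrightarrow> codiff c xs = 0"
    using c unfolding cocycle_def for_small_def by blast
  define \<W> where "\<W> = {W. openin Y W \<and> (\<exists>D\<in>\<D>. W \<inter> K \<subseteq> D)}"
  have cover: "x \<in> \<Union>\<W>" if x: "x \<in> K" for x
  proof -
    have "x \<in> \<Union>\<D>" using x K_sub D(1) by (auto simp: open_cover_def)
    then obtain D where "D \<in> \<D>" "x \<in> D" by (rule UnionE)
    then obtain D' where "openin Y D'" "D = D' \<inter> K"
      using D(1) by (auto simp: open_cover_def openin_subtopology)
    then show ?thesis using \<open>D \<in> \<D>\<close> \<open>x \<in> D\<close> unfolding \<W>_def by blast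
  qed
  obtain r g where g: "\<And>x. x \<in> topspace Y \<Longrightarrow> g x \<in> K" "\<And>x. x \<in> K \<Longrightarrow> g x = r x"
    and small: "for_small Y (\<lambda>xs. \<exists>W\<in>\<W>. r ` set xs \<union> g ` set xs \<subseteq> W)"
    and hom: "cobounds q (subtopology Y K) (\<lambda>xs. c xs - c (map r xs))"
  proof (rule push_into_K[of \<W>])
    show "openin Y W" if "W \<in> \<W>" for W using that by (simp add: \<W>_def)
    show "K \<subseteq> \<Union>\<W>" by (rule subsetI) (rule cover)
  qed (use c in blast)
  have "cocycle q Y (\<lambda>xs. c (map g xs))"
    unfolding cocycle_def
  proof (rule for_small_mono[OF small], rule impI)
    fix xs assume xs: "set xs \<subseteq> topspace Y" "\<exists>W\<in>\<W>. r ` set xs \<union> g ` set xs \<subseteq> W" "length xs = Suc (Suc q)"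
    then obtain W where W: "W \<in> \<W>" "g ` set xs \<subseteq> W" by auto
    obtain D where "D \<in> \<D>" "W \<inter> K \<subseteq> D" using W(1) by (auto simp: \<W>_def)
    moreover have "g ` set xs \<subseteq> K" using g xs(1) by auto
    ultimately have "D \<in> \<D>" "g ` set xs \<subseteq> D" using W(2) by auto
    then show "codiff (\<lambda>xs. c (map g xs)) xs = 0" using D(2) xs(3) by (simp flip: codiff_map)
  qed
  moreover have "cobounds q (subtopology Y K) (\<lambda>xs. c xs - c (map g xs))"
  proof (rule cobounds_cong[OF hom])
    fix xs assume "set xs \<subseteq> topspace (subtopology Y K)"
    then have "map r xs = map g xs" using g(2) by (intro map_cong) auto
    then show "c xs - c (map r xs) = c xs - c (map g xs)" by (simp only:)
  qed
  ultimately show ?thesis by blast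
qed

end

theorem corollary9:
  fixes X :: "'a topology" and \<phi> :: "'a \<Rightarrow> real \<Rightarrow> 'a" and K Z :: "'a set"
    and T :: "real set" and q :: nat
  assumes "T = UNIV \<and> flow X \<phi> \<or> T = {0..} \<and> semiflow X \<phi>"
    and "attractor T X \<phi> K"
    and "Z = basin X \<phi> K"
    and "Hausdorff_space (subtopology X Z)" and "paracompact_space (subtopology X Z)"
  shows "(cech_induced q (subtopology X K) (\<lambda>x. x) ::
            ('a list \<Rightarrow> 'k::field) set set \<Rightarrow> ('a list \<Rightarrow> 'k) set set)
         \<in> linear_iso (cech_cohomology q (subtopology X Z)) (cech_cohomology q (subtopology X K))"
proof -
  note basin = basin_entrance[OF assms]
  interpret deformable_pair "subtopology X Z" \<phi> K
    by unfold_locales (use basin assms(4,5) in \<open>auto simp: compactin_subtopology\<close>)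
  have sub: "subtopology (subtopology X Z) K = subtopology X K"
    using basin(2) by (simp add: subtopology_subtopology inf_absorb2)
  show ?thesis
  proof (rule cech_induced_linear_iso)
    show "continuous_map (subtopology X K) (subtopology X Z) (\<lambda>x. x)"
      using basin(2) by (auto simp: continuous_map_in_subtopology intro: continuous_map_from_subtopology)
  qed (use restriction_injective restriction_surjective in \<open>simp_all add: sub\<close>)
qed

end
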